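(* Let $s,t$ be positive integers. For every finite graph $G$ with $\widetilde{\omega}(G) \leq s$ and $\mathsf{cideg}(G) \leq t$, every two sets $A,B \subseteq V(G)$, and every positive integer $k$, there either exists an induced $A$-$B$-linkage of order $k$ in $G$, or a set $S\subseteq V(G)$ with $\theta(G[S]) \leq k \cdot (t(s-1)+1)^{t^2(s-1)^2+1}$ such that there exists no $A$-$B$-path in $G-S$.
   Context: All graphs are finite and simple. A maximal clique of $G$ is an inclusion-maximal set of pairwise adjacent vertices. Two vertices $v,w$ of $G$ are equivalent if they belong to exactly the same maximal cliques of $G$ (equivalently, $v=w$ or they are adjacent true twins, $N[v]=N[w]$). The clique-incidence-diversity $\widetilde{\omega}(G)$ is the maximum, over all maximal cliques $K$ of $G$, of the number of equivalence classes that intersect $K$. The clique-incidence-degree $\mathsf{cideg}(G)$ is the maximum, over all vertices $v$, of the number of maximal cliques of $G$ containing $v$. $\theta(H)$ denotes the clique-cover number of $H$ (the minimum number of cliques whose union is $V(H)$). An $A$-$B$-linkage of order $k$ is a subgraph $L$ of $G$ consisting of $k$ pairwise vertex-disjoint $A$-$B$-paths; it is induced if $L=G[V(L)]$. *)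

theory Defs
  imports Main
begin

definition graph :: "'a set \<Rightarrow> ('a \<Rightarrow> 'a \<Rightarrow> bool) \<Rightarrow> bool" where
  "graph V E \<longleftrightarrow> finite V \<and> (\<forall>u v. E u v \<longrightarrow> u \<in> V \<and> v \<in> V)
     \<and> (\<forall>u v. E u v \<longrightarrow> E v u) \<and> (\<forall>v. \<not> E v v)"

definition clique :: "'a set \<Rightarrow> ('a \<Rightarrow> 'a \<Rightarrow> bool) \<Rightarrow> 'a set \<Rightarrow> bool" where
  "clique V E K \<longleftrightarrow> K \<subseteq> V \<and> (\<forall>u\<in>K. \<forall>v\<in>K. u \<noteq> v \<longrightarrow> E u v)"

definition max_clique :: "'a set \<Rightarrow> ('a \<Rightarrow> 'a \<Rightarrow> bool) \<Rightarrow> 'a set \<Rightarrow> bool" where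
  "max_clique V E K \<longleftrightarrow> clique V E K \<and> (\<forall>K'. clique V E K' \<and> K \<subseteq> K' \<longrightarrow> K' = K)"

definition clique_equiv :: "'a set \<Rightarrow> ('a \<Rightarrow> 'a \<Rightarrow> bool) \<Rightarrow> ('a \<times> 'a) set" where
  "clique_equiv V E = {(v, w). v \<in> V \<and> w \<in> V \<and>
      {K. max_clique V E K \<and> v \<in> K} = {K. max_clique V E K \<and> w \<in> K}}"

definition cid :: "'a set \<Rightarrow> ('a \<Rightarrow> 'a \<Rightarrow> bool) \<Rightarrow> nat" where
  "cid V E = Sup {card {C \<in> V // clique_equiv V E. C \<inter> K \<noteq> {}} | K. max_clique V E K}"

definition cideg :: "'a set \<Rightarrow> ('a \<Rightarrow> 'a \<Rightarrow> bool) \<Rightarrow> nat" where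
  "cideg V E = Sup {card {K. max_clique V E K \<and> v \<in> K} | v. v \<in> V}"

definition clique_cover_number :: "'a set \<Rightarrow> ('a \<Rightarrow> 'a \<Rightarrow> bool) \<Rightarrow> 'a set \<Rightarrow> nat" where
  "clique_cover_number V E S =
     Inf {card \<C> | \<C>. finite \<C> \<and> (\<forall>C\<in>\<C>. clique S E C) \<and> \<Union>\<C> = S}"

definition is_path :: "'a set \<Rightarrow> ('a \<Rightarrow> 'a \<Rightarrow> bool) \<Rightarrow> 'a list \<Rightarrow> bool" where
  "is_path V E p \<longleftrightarrow> p \<noteq> [] \<and> distinct p \<and> set p \<subseteq> V \<and>
     (\<forall>i. Suc i < length p \<longrightarrow> E (p ! i) (p ! Suc i))"

definition AB_path :: "'a set \<Rightarrow> ('a \<Rightarrow> 'a \<Rightarrow> bool) \<Rightarrow> 'a set \<Rightarrow> 'a set \<Rightarrow> 'a list \<Rightarrow> bool" where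
  "AB_path V E A B p \<longleftrightarrow> is_path V E p \<and> set p \<inter> A = {hd p} \<and> set p \<inter> B = {last p}"

text \<open>An induced A-B-linkage of order k: k pairwise vertex-disjoint A-B-paths such that
  the union subgraph L of the paths equals G[V(L)], i.e. every edge of G between vertices
  of L is an edge of one of the paths.\<close>
definition induced_linkage ::
  "'a set \<Rightarrow> ('a \<Rightarrow> 'a \<Rightarrow> bool) \<Rightarrow> 'a set \<Rightarrow> 'a set \<Rightarrow> nat \<Rightarrow> 'a list list \<Rightarrow> bool" where
  "induced_linkage V E A B k Ps \<longleftrightarrow>
     length Ps = k \<and> (\<forall>P\<in>set Ps. AB_path V E A B P) \<and>
     (\<forall>i j. i < k \<and> j < k \<and> i \<noteq> j \<longrightarrow> set (Ps ! i) \<inter> set (Ps ! j) = {}) \<and>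
     (\<forall>u\<in>\<Union>P\<in>set Ps. set P. \<forall>v\<in>\<Union>P\<in>set Ps. set P. E u v \<longrightarrow>
        (\<exists>P\<in>set Ps. \<exists>i. Suc i < length P \<and> {P ! i, P ! Suc i} = {u, v}))"

end

theory Submission
  imports Defs
begin

text \<open>
  Let \<open>D = t (s - 1)\<close>. A closed neighbourhood is the union of at most \<open>t\<close> maximal cliques, so it
  meets at most \<open>D + 1\<close> equivalence classes, and the classes can be coloured with \<open>D\<^sup>2 + 1\<close>
  colours such that vertices of equal colour in different classes have disjoint closed
  neighbourhoods. If every separator uses at least \<open>k (D + 1) ^ (D\<^sup>2 + 1)\<close> classes, go through
  the colours one at a time: contract the neighbourhoods of the vertices of the current colour, apply
  Menger's theorem, and keep only the vertices on the resulting paths. Each step loses a factor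
  \<open>D + 1\<close>, and from then on every vertex of that colour has, among the vertices kept, no
  neighbours other than its neighbours on a path. At the end the remaining \<open>k\<close> disjoint paths
  form an induced linkage.
\<close>

section \<open>Menger's theorem\<close>

text \<open>Menger's theorem yields disjoint paths but says nothing about edges between them. If
  \<open>N[x]\<close> is contracted to one point, at most one path meets \<open>N[x]\<close>; when
  \<open>x\<close> is kept, its kept neighbours therefore all lie on its own path, and choosing that
  path chordless leaves only its neighbours along the path. Contracting several neighbourhoods at
  once needs them disjoint (or equal, for twins), which is why colours appear. The number of colours
  comes from counting classes within distance two of a given class: at most \<open>D\<close> classes
  in between, each leading to at most \<open>D\<close> others.

  A later round may choose quite different paths, so what a round gains has to be a property of the
  set of kept vertices. A degree bound is one, since it survives every shrinking of that set.

  Separators are measured in classes because a class is a clique: a separator made of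
  \<open>n\<close> classes has clique-cover number at most \<open>n\<close>. A contracted point
  unfolds into the classes meeting one closed neighbourhood, at most \<open>D + 1\<close> of them,
  and this is the factor lost per colour.\<close>

definition walk :: "('a \<Rightarrow> 'a \<Rightarrow> bool) \<Rightarrow> 'a set \<Rightarrow> 'a set \<Rightarrow> 'a list \<Rightarrow> bool" where
  "walk R A B p \<longleftrightarrow> p \<noteq> [] \<and> hd p \<in> A \<and> last p \<in> B \<and> successively R p"

lemma walk_mono:
  assumes "walk R A B p" "\<And>x y. x \<in> set p \<Longrightarrow> y \<in> set p \<Longrightarrow> R x y \<Longrightarrow> R' x y"
  shows "walk R' A B p"
  using assms successively_mono[of R p R'] unfolding walk_def by blast

lemma walk_split:
  assumes "walk R A B (xs @ v # ys)"
  shows "walk R A {v} (xs @ [v])" and "walk R {v} B (v # ys)"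
proof -
  have "successively R (xs @ [v]) \<and> successively R (v # ys)"
    using assms unfolding walk_def by (auto simp: successively_append_iff)
  moreover have "hd (xs @ [v]) \<in> A" using assms by (cases xs) (auto simp: walk_def)
  moreover have "last (v # ys) \<in> B" using assms by (simp add: walk_def)
  ultimately show "walk R A {v} (xs @ [v])" "walk R {v} B (v # ys)" by (simp_all add: walk_def)
qed

lemma walk_join:
  assumes "walk R A X (xs @ [v])" "walk R Y B (v # ys)"
  shows "walk R A B (xs @ v # ys)"
proof -
  have "successively R (xs @ v # ys)"
    using assms unfolding walk_def by (auto simp: successively_append_iff)
  moreover have "hd (xs @ v # ys) \<in> A" using assms(1) by (cases xs) (auto simp: walk_def)
  moreover have "last (xs @ v # ys) \<in> B" using assms(2) by (simp add: walk_def)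
  ultimately show ?thesis by (simp add: walk_def)
qed

lemma walk_concat:
  assumes "walk R A X p" "walk R Y B q" "R (last p) (hd q)"
  shows "walk R A B (p @ q)"
  using assms by (auto simp: walk_def successively_append_iff)

lemma successively_avoid_source:
  assumes "successively R (xs @ [v])" "x \<notin> set xs"
  shows "successively (\<lambda>a b. R a b \<and> (a, b) \<noteq> (x, y)) (xs @ [v])"
  using assms
proof (induction xs)
  case (Cons a xs)
  then show ?case by (cases xs) auto
qed auto

lemma successively_avoid_target:
  assumes "successively R (v # ys)" "y \<notin> set ys"
  shows "successively (\<lambda>a b. R a b \<and> (a, b) \<noteq> (x, y)) (v # ys)"
  using assms by (induction ys arbitrary: v) auto

text \<open>Stopping at the first vertex of \<open>insert x S\<close> leaves \<open>x\<close>
  nowhere but at the end, so the edge out of \<open>x\<close> is never traversed.\<close>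

lemma walk_prefix_avoiding:
  assumes "walk R A B p" "set p \<inter> insert x S \<noteq> {}"
  obtains q where "walk (\<lambda>a b. R a b \<and> (a, b) \<noteq> (x, y)) A (insert x S) q" "set q \<subseteq> set p"
proof -
  obtain xs v ys where p: "p = xs @ v # ys" and v: "v \<in> insert x S" "\<forall>z\<in>set xs. z \<notin> insert x S"
    using split_list_first_prop[of p "\<lambda>z. z \<in> insert x S"] assms(2) by blast
  have "walk R A {v} (xs @ [v])" using walk_split(1)[of R A B xs v ys] assms(1) p by simp
  then have "walk (\<lambda>a b. R a b \<and> (a, b) \<noteq> (x, y)) A (insert x S) (xs @ [v])"
    using v successively_avoid_source[of R xs v x y] unfolding walk_def by auto
  then show ?thesis by (rule that) (auto simp: p)
qed

lemma walk_suffix_avoiding: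
  assumes "walk R A B p" "set p \<inter> insert y S \<noteq> {}"
  obtains q where "walk (\<lambda>a b. R a b \<and> (a, b) \<noteq> (x, y)) (insert y S) B q" "set q \<subseteq> set p"
proof -
  obtain xs v ys where p: "p = xs @ v # ys" and v: "v \<in> insert y S" "\<forall>z\<in>set ys. z \<notin> insert y S"
    using split_list_last_prop[of p "\<lambda>z. z \<in> insert y S"] assms(2) by blast
  have "walk R {v} B (v # ys)" using walk_split(2)[of R A B xs v ys] assms(1) p by simp
  then have "walk (\<lambda>a b. R a b \<and> (a, b) \<noteq> (x, y)) (insert y S) B (v # ys)"
    using v successively_avoid_target[of R v ys y x] unfolding walk_def by auto
  then show ?thesis by (rule that) (auto simp: p)
qed

text \<open>Finiteness is demanded because \<open>card\<close> of an infinite set is 0, so an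
  infinite separator would count as small.\<close>

definition separator :: "('a \<Rightarrow> 'a \<Rightarrow> bool) \<Rightarrow> 'a set \<Rightarrow> 'a set \<Rightarrow> 'a set \<Rightarrow> bool" where
  "separator R A B S \<longleftrightarrow> finite S \<and> (\<forall>p. walk R A B p \<longrightarrow> set p \<inter> S \<noteq> {})"

definition disjoint_paths ::
  "('a \<Rightarrow> 'a \<Rightarrow> bool) \<Rightarrow> 'a set \<Rightarrow> 'a set \<Rightarrow> 'a list set \<Rightarrow> bool" where
  "disjoint_paths R A B P \<longleftrightarrow> (\<forall>p\<in>P. walk R A B p \<and> distinct p) \<and>
     (\<forall>p\<in>P. \<forall>q\<in>P. p \<noteq> q \<longrightarrow> set p \<inter> set q = {})"

lemma inverse_of_injective_choice:
  assumes "inj_on g P" "g ` P \<subseteq> X" "finite X" "card P = card X"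
  obtains h where "\<And>s. s \<in> X \<Longrightarrow> h s \<in> P \<and> g (h s) = s"
proof -
  have "g ` P = X" using assms by (metis card_image card_subset_eq)
  then show ?thesis using that[of "inv_into P g"] by (simp add: f_inv_into_f inv_into_into)
qed

text \<open>Disjoint paths have different ends. With as many paths as elements of \<open>X\<close>,
  every element is the end of exactly one path, so the system can be indexed by \<open>X\<close>,
  ready for gluing.\<close>

lemma disjoint_paths_by_end:
  assumes "disjoint_paths R A X P" "card P = card X" "finite X"
  obtains h where "\<And>s. s \<in> X \<Longrightarrow> walk R A X (h s) \<and> distinct (h s) \<and> last (h s) = s"
    "\<And>s z. s \<in> X \<Longrightarrow> z \<in> X \<Longrightarrow> s \<noteq> z \<Longrightarrow> set (h s) \<inter> set (h z) = {}"
proof -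
  have "last p \<in> set p" "last p \<in> X" if "p \<in> P" for p
    using that assms(1) unfolding disjoint_paths_def walk_def by auto
  moreover have "inj_on last P"
  proof (rule inj_onI, rule ccontr)
    fix p q assume *: "p \<in> P" "q \<in> P" "last p = last q" "p \<noteq> q"
    then have "set p \<inter> set q = {}" using assms(1) unfolding disjoint_paths_def by blast
    moreover have "last p \<in> set p" "last p \<in> set q" using \<open>\<And>p. p \<in> P \<Longrightarrow> last p \<in> set p\<close>[of p] \<open>\<And>p. p \<in> P \<Longrightarrow> last p \<in> set p\<close>[of q] * by simp_all
    ultimately show False by blast
  qed
  ultimately obtain h where h: "\<And>s. s \<in> X \<Longrightarrow> h s \<in> P \<and> last (h s) = s"
    using inverse_of_injective_choice[of last P X] assms(2,3) by blast
  show ?thesis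
  proof (rule that[of h])
    show "walk R A X (h s) \<and> distinct (h s) \<and> last (h s) = s" if "s \<in> X" for s
      using h[OF that] assms(1) unfolding disjoint_paths_def by blast
    show "set (h s) \<inter> set (h z) = {}" if "s \<in> X" "z \<in> X" "s \<noteq> z" for s z
    proof -
      have "h s \<noteq> h z" using h[OF that(1)] h[OF that(2)] that(3) by metis
      then show ?thesis
        using h[OF that(1)] h[OF that(2)] assms(1) unfolding disjoint_paths_def by blast
    qed
  qed
qed

lemma disjoint_paths_by_start:
  assumes "disjoint_paths R X B P" "card P = card X" "finite X"
  obtains h where "\<And>s. s \<in> X \<Longrightarrow> walk R X B (h s) \<and> distinct (h s) \<and> hd (h s) = s"
    "\<And>s z. s \<in> X \<Longrightarrow> z \<in> X \<Longrightarrow> s \<noteq> z \<Longrightarrow> set (h s) \<inter> set (h z) = {}"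
proof -
  have "hd p \<in> set p" "hd p \<in> X" if "p \<in> P" for p
    using that assms(1) unfolding disjoint_paths_def walk_def by auto
  moreover have "inj_on hd P"
  proof (rule inj_onI, rule ccontr)
    fix p q assume *: "p \<in> P" "q \<in> P" "hd p = hd q" "p \<noteq> q"
    then have "set p \<inter> set q = {}" using assms(1) unfolding disjoint_paths_def by blast
    moreover have "hd p \<in> set p" "hd p \<in> set q" using \<open>\<And>p. p \<in> P \<Longrightarrow> hd p \<in> set p\<close>[of p] \<open>\<And>p. p \<in> P \<Longrightarrow> hd p \<in> set p\<close>[of q] * by simp_all
    ultimately show False by blast
  qed
  ultimately obtain h where h: "\<And>s. s \<in> X \<Longrightarrow> h s \<in> P \<and> hd (h s) = s"
    using inverse_of_injective_choice[of hd P X] assms(2,3) by blast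
  show ?thesis
  proof (rule that[of h])
    show "walk R X B (h s) \<and> distinct (h s) \<and> hd (h s) = s" if "s \<in> X" for s
      using h[OF that] assms(1) unfolding disjoint_paths_def by blast
    show "set (h s) \<inter> set (h z) = {}" if "s \<in> X" "z \<in> X" "s \<noteq> z" for s z
    proof -
      have "h s \<noteq> h z" using h[OF that(1)] h[OF that(2)] that(3) by metis
      then show ?thesis
        using h[OF that(1)] h[OF that(2)] assms(1) unfolding disjoint_paths_def by blast
    qed
  qed
qed

lemma disjoint_paths_mono:
  assumes "disjoint_paths R A B P" "\<And>x y. R x y \<Longrightarrow> R' x y"
  shows "disjoint_paths R' A B P"
  unfolding disjoint_paths_def
proof (intro conjI ballI)
  show "walk R' A B p" "distinct p" if "p \<in> P" for p
    using assms that walk_mono[of R A B p R'] unfolding disjoint_paths_def by simp_all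
qed (use assms(1) in \<open>simp add: disjoint_paths_def\<close>)

lemma disjoint_paths_of_family:
  assumes "\<And>i. i \<in> I \<Longrightarrow> walk R A B (h i) \<and> distinct (h i)"
    and "\<And>i j. i \<in> I \<Longrightarrow> j \<in> I \<Longrightarrow> i \<noteq> j \<Longrightarrow> set (h i) \<inter> set (h j) = {}"
  shows "disjoint_paths R A B (h ` I)" "card (h ` I) = card I"
proof -
  have "inj_on h I"
  proof (rule inj_onI, rule ccontr)
    fix i j assume *: "i \<in> I" "j \<in> I" "h i = h j" "i \<noteq> j"
    then have "set (h i) = {}" using assms(2)[of i j] by simp
    then show False using assms(1)[of i] * by (simp add: walk_def)
  qed
  then show "card (h ` I) = card I" by (rule card_image)
  show "disjoint_paths R A B (h ` I)" 
    unfolding disjoint_paths_def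
  proof (intro conjI ballI impI)
    show "walk R A B p" "distinct p" if "p \<in> h ` I" for p using that assms(1) by auto
    show "set p \<inter> set q = {}" if "p \<in> h ` I" "q \<in> h ` I" "p \<noteq> q" for p q
      using that assms(2) by fast
  qed
qed

text \<open>Goering's proof: if deleting the edge \<open>x y\<close> creates a separator \<open>S\<close> that is too small, then
  a linkage from \<open>A\<close> to \<open>S \<union> {x}\<close> and one from \<open>S \<union> {y}\<close> to \<open>B\<close>, both avoiding the
  edge, can only meet in \<open>S\<close>, and they are glued along \<open>S\<close> and the edge.\<close>

theorem menger:
  fixes r :: "('a \<times> 'a) set"
  assumes "finite r" "finite A"
    and "\<And>S. separator (\<lambda>x y. (x, y) \<in> r) A B S \<Longrightarrow> k \<le> card S"
  shows "\<exists>P. card P = k \<and> disjoint_paths (\<lambda>x y. (x, y) \<in> r) A B P"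
  using assms
\<comment> \<open>\<open>A\<close> and \<open>B\<close> vary because the two smaller instances end
  in \<open>insert x S\<close> and start in \<open>insert y S\<close>.\<close>
proof (induction "card r" arbitrary: r A B rule: less_induct)
  case less
  show ?case
  proof (cases "r = {}")
    case True
    \<comment> \<open>Without edges a walk is a single vertex, so \<open>A \<inter> B\<close> is a
      separator; it is finite because \<open>A\<close> is.\<close>
    have "set p \<inter> (A \<inter> B) \<noteq> {}" if "walk (\<lambda>x y. (x, y) \<in> r) A B p" for p
      using that True by (cases p; cases "tl p") (auto simp: walk_def)
    then have "k \<le> card (A \<inter> B)" using less.prems by (simp add: separator_def)
    then obtain I where "I \<subseteq> A \<inter> B" "card I = k" by (metis obtain_subset_with_card_n)
    then show ?thesis
      using disjoint_paths_of_family[of I "\<lambda>x y. (x, y) \<in> r" A B "\<lambda>i. [i]"]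
      by (auto simp: walk_def)
  next
    case False
    then obtain x y where xy: "(x, y) \<in> r" by auto
    define r' where "r' = r - {(x, y)}"
    define R where "R = (\<lambda>a b. (a, b) \<in> r)"
    define R' where "R' = (\<lambda>a b. (a, b) \<in> r')"
    have R'_eq: "R' = (\<lambda>a b. R a b \<and> (a, b) \<noteq> (x, y))" by (auto simp: R_def R'_def r'_def)
    have R'R: "R a b" if "R' a b" for a b using that by (simp add: R'_eq)
    have walk_R: "walk R A' B' p" if "walk R' A' B' p" for A' B' p
      using that by (rule walk_mono) (rule R'R)
    have r': "finite r'" "card r' < card r"
      using less.prems(1) xy unfolding r'_def by (simp, meson card_Diff1_less)
    have sepR: "k \<le> card S" if "separator R A B S" for S
      using less.prems(3) that unfolding R_def by blast
    have IH: "\<exists>P. card P = k \<and> disjoint_paths R' A' B' P"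
      if "finite A'" "\<And>S. separator R' A' B' S \<Longrightarrow> k \<le> card S" for A' B'
      using less.hyps[OF r'(2,1) that(1)] that(2) unfolding R'_def by blast
    show ?thesis
    proof (cases "\<forall>S. separator R' A B S \<longrightarrow> k \<le> card S")
      case True
      then obtain P where "card P = k" "disjoint_paths R' A B P" using IH less.prems(2) by blast
      then show ?thesis using disjoint_paths_mono[of R' A B P R] R'R unfolding R_def by blast
    next
      case False
      then obtain S where S: "separator R' A B S" "card S < k" by auto
      have finS: "finite S" using S by (simp add: separator_def)
      \<comment> \<open>A walk that misses \<open>x\<close> or \<open>y\<close> cannot use the
        deleted edge, so it already meets \<open>S\<close>.\<close>
      have meets: "set p \<inter> insert x S \<noteq> {}" "set p \<inter> insert y S \<noteq> {}" if "walk R A B p" for p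
      proof -
        have *: "walk R' A B p" if "x \<notin> set p \<or> y \<notin> set p"
          using \<open>walk R A B p\<close> by (rule walk_mono) (use that in \<open>auto simp: R'_eq\<close>)
        show "set p \<inter> insert x S \<noteq> {}" "set p \<inter> insert y S \<noteq> {}"
          using * S(1) unfolding separator_def by blast+
      qed
      have "separator R A B (insert x S)" "separator R A B (insert y S)"
        using meets finS unfolding separator_def by blast+
      then have "k \<le> card (insert x S)" "k \<le> card (insert y S)" using sepR by blast+
      \<comment> \<open>\<open>card S < k\<close>, yet one extra vertex brings it to at least
        \<open>k\<close>: both enlarged sets have exactly \<open>k\<close> elements.\<close>
      then have cards: "card (insert x S) = k" "card (insert y S) = k" "x \<notin> S" "y \<notin> S"
        using S(2) finS by (auto simp: card_insert_if split: if_splits)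
      \<comment> \<open>Every \<open>A\<close>-\<open>B\<close> walk of \<open>R\<close> has a part
        running from \<open>A\<close> to \<open>insert x S\<close> without the deleted edge. Hence
        \<open>T\<close>, which blocks these parts in \<open>R'\<close>, separates \<open>A\<close>
        from \<open>B\<close> in \<open>R\<close>.\<close>
      have "k \<le> card T" if T: "separator R' A (insert x S) T" for T
      proof (rule sepR)
        show "separator R A B T"
          unfolding separator_def
        proof (intro conjI allI impI)
          show "finite T" using T by (simp add: separator_def)
          fix p assume "walk R A B p"
          then obtain q where "walk R' A (insert x S) q" "set q \<subseteq> set p"
            using walk_prefix_avoiding[of R A B p x S y] meets(1) unfolding R'_eq by blast
          then show "set p \<inter> T \<noteq> {}" using T unfolding separator_def by blast
        qed
      qed
      then obtain P where P: "card P = card (insert x S)" "disjoint_paths R' A (insert x S) P"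
        using IH[OF less.prems(2)] cards by metis
      have "k \<le> card T" if T: "separator R' (insert y S) B T" for T
      proof (rule sepR)
        show "separator R A B T"
          unfolding separator_def
        proof (intro conjI allI impI)
          show "finite T" using T by (simp add: separator_def)
          fix p assume "walk R A B p"
          then obtain q where "walk R' (insert y S) B q" "set q \<subseteq> set p"
            using walk_suffix_avoiding[of R A B p y S x] meets(2) unfolding R'_eq by blast
          then show "set p \<inter> T \<noteq> {}" using T unfolding separator_def by blast
        qed
      qed
      then obtain Q where Q: "card Q = card (insert y S)" "disjoint_paths R' (insert y S) B Q"
        using IH[of "insert y S"] finS cards by (metis finite_insert)
      obtain p where p: "\<And>s. s \<in> insert x S \<Longrightarrow> walk R' A (insert x S) (p s) \<and> distinct (p s) \<and> last (p s) = s"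
        and p_disj: "\<And>s z. s \<in> insert x S \<Longrightarrow> z \<in> insert x S \<Longrightarrow> s \<noteq> z \<Longrightarrow> set (p s) \<inter> set (p z) = {}"
        using disjoint_paths_by_end[OF P(2,1)] finS by blast
      obtain q where q: "\<And>s. s \<in> insert y S \<Longrightarrow> walk R' (insert y S) B (q s) \<and> distinct (q s) \<and> hd (q s) = s"
        and q_disj: "\<And>s z. s \<in> insert y S \<Longrightarrow> z \<in> insert y S \<Longrightarrow> s \<noteq> z \<Longrightarrow> set (q s) \<inter> set (q z) = {}"
        using disjoint_paths_by_start[OF Q(2,1)] finS by blast
      have p_end: "z = s" if "z \<in> set (p s)" "z \<in> S" "s \<in> insert x S" for z s
      proof -
        have "z \<in> set (p z)" using p[of z] that unfolding walk_def by (metis insertI2 last_in_set)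
        then show ?thesis using p_disj[of z s] that by blast
      qed
      have q_start: "z = s" if "z \<in> set (q s)" "z \<in> S" "s \<in> insert y S" for z s
      proof -
        have "z \<in> set (q z)" using q[of z] that unfolding walk_def by (metis insertI2 hd_in_set)
        then show ?thesis using q_disj[of z s] that by blast
      qed
      \<comment> \<open>Following \<open>p s\<close> up to \<open>v\<close> and \<open>q s'\<close>
        from there on gives an \<open>A\<close>-\<open>B\<close> walk of \<open>R'\<close>, which
        must meet \<open>S\<close>. Since \<open>p s\<close> can meet \<open>S\<close> only in its
        last vertex and \<open>q s'\<close> only in its first, the meeting point is \<open>v\<close>
        itself.\<close>
      have cross: "v \<in> S \<and> v = s \<and> v = s'"
        if v: "v \<in> set (p s)" "v \<in> set (q s')" and s: "s \<in> insert x S" "s' \<in> insert y S" for v s s'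
      proof -
        obtain xs zs where ps: "p s = xs @ v # zs" using v(1) by (meson split_list)
        obtain xs' zs' where qs: "q s' = xs' @ v # zs'" using v(2) by (meson split_list)
        have "walk R' A {v} (xs @ [v])" using p[OF s(1)] walk_split(1)[of R' A "insert x S" xs v zs] ps by simp
        moreover have "walk R' {v} B (v # zs')" using q[OF s(2)] walk_split(2)[of R' "insert y S" B xs' v zs'] qs by simp
        ultimately have "walk R' A B (xs @ v # zs')" by (rule walk_join)
        then obtain z where z: "z \<in> S" "z \<in> set xs \<or> z = v \<or> z \<in> set zs'"
          using S(1) unfolding separator_def by fastforce
        have "z \<notin> set xs"
        proof
          assume zx: "z \<in> set xs"
          then have "z = s" using p_end[of z s] z(1) s(1) ps by auto
          then have "last (v # zs) = z" using p[OF s(1)] ps by simp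
          then have "z \<in> set (v # zs)" by (metis last_in_set list.distinct(1))
          then show False using p[OF s(1)] ps zx by auto
        qed
        moreover have "z \<notin> set zs'"
        proof
          assume zx: "z \<in> set zs'"
          then have "z = s'" using q_start[of z s'] z(1) s(2) qs by auto
          then have "hd (xs' @ [v]) = z" using q[OF s(2)] qs by (cases xs') auto
          then have "z \<in> set (xs' @ [v])" by (metis hd_in_set snoc_eq_iff_butlast)
          then show False using q[OF s(2)] qs zx by auto
        qed
        ultimately have "z = v" using z(2) by blast
        then show ?thesis using p_end[of v s] q_start[of v s'] z(1) v s by blast
      qed
      \<comment> \<open>Where each path continues: at its own end if that lies in \<open>S\<close>,
        and at \<open>y\<close>, across the deleted edge, if it is \<open>x\<close>.\<close>
      define \<sigma> where "\<sigma> s = (if s = x then y else s)" for s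
      define h where "h s = p s @ (if s = x then q y else tl (q s))" for s
      have \<sigma>: "\<sigma> s \<in> insert y S" if "s \<in> insert x S" for s using that by (auto simp: \<sigma>_def)
      have \<sigma>_inj: "\<sigma> s \<noteq> \<sigma> z" if "s \<in> insert x S" "z \<in> insert x S" "s \<noteq> z" for s z
        using that cards(4) by (auto simp: \<sigma>_def)
      have h_set: "set (h s) \<subseteq> set (p s) \<union> set (q (\<sigma> s))" for s
        by (cases "q s") (auto simp: h_def \<sigma>_def)
      have "walk R A B (h s) \<and> distinct (h s)" if s: "s \<in> insert x S" for s
      proof (cases "s = x")
        case True
        have "walk R A (insert x S) (p x)" "walk R (insert y S) B (q y)"
          using walk_R[of A "insert x S" "p x"] walk_R[of "insert y S" B "q y"] p[of x] q[of y] by simp_all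
        moreover have "R (last (p x)) (hd (q y))" using p[of x] q[of y] xy by (simp add: R_def)
        ultimately have "walk R A B (h x)" unfolding h_def by (auto intro: walk_concat)
        moreover have "set (p x) \<inter> set (q y) = {}" using cross[of _ x y] cards(3) by blast
        ultimately show ?thesis using True p[of x] q[of y] by (simp add: h_def)
      next
        case False
        then have sS: "s \<in> S" using s by simp
        have w: "walk R A (insert x S) (p s)" "walk R (insert y S) B (q s)"
          using walk_R[of A "insert x S" "p s"] walk_R[of "insert y S" B "q s"] p[of s] q[of s] sS
          by simp_all
        have "p s = butlast (p s) @ [s]"
          using p[of s] sS append_butlast_last_id[of "p s"] by (simp add: walk_def)
        then obtain xs where ps: "p s = xs @ [s]" by blast
        have "q s = s # tl (q s)"
          using q[of s] sS list.collapse[of "q s"] by (simp add: walk_def)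
        then obtain ys where qs: "q s = s # ys" by blast
        have hs: "h s = xs @ s # ys" using False ps qs by (simp add: h_def)
        then have "walk R A B (h s)" using w walk_join[of R A "insert x S" xs s "insert y S" B ys] ps qs by simp
        moreover have "distinct (h s)"
        proof -
          have d: "distinct (xs @ [s])" "distinct (s # ys)" using p[of s] q[of s] sS ps qs by auto
          have "set xs \<inter> set ys = {}"
            using cross[of _ s s] sS ps qs d by fastforce
          then show ?thesis using d hs by auto
        qed
        ultimately show ?thesis by blast
      qed
      moreover have "set (h s) \<inter> set (h z) = {}"
        if sz: "s \<in> insert x S" "z \<in> insert x S" "s \<noteq> z" for s z
      proof -
        have c: "set (p a) \<inter> set (q (\<sigma> b)) = {}"
          if "a \<in> insert x S" "b \<in> insert x S" "a \<noteq> b" for a b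
          using cross[of _ a "\<sigma> b"] that \<sigma>[of b] cards(3,4) unfolding \<sigma>_def by (auto split: if_splits)
        show ?thesis
          using h_set[of s] h_set[of z] p_disj[OF sz] q_disj[OF \<sigma>[OF sz(1)] \<sigma>[OF sz(2)] \<sigma>_inj[OF sz]]
            c[OF sz] c[OF sz(2,1)] sz(3) by blast
      qed
      ultimately have "disjoint_paths R A B (h ` insert x S)" "card (h ` insert x S) = card (insert x S)"
        using disjoint_paths_of_family[of "insert x S" R A B h] by blast+
      then show ?thesis using cards(1) unfolding R_def by metis
    qed
  qed
qed

section \<open>Chordless paths\<close>

definition chordless :: "('a \<Rightarrow> 'a \<Rightarrow> bool) \<Rightarrow> 'a list \<Rightarrow> bool" where
  "chordless E p \<longleftrightarrow> (\<forall>i j. Suc i < j \<and> j < length p \<longrightarrow> \<not> E (p ! i) (p ! j))"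

lemma walk_take:
  assumes "walk E A B p" "i < length p"
  shows "walk E A {p ! i} (take (Suc i) p)"
  using walk_split(1)[of E A B "take i p" "p ! i" "drop (Suc i) p"] assms
  by (simp add: id_take_nth_drop[symmetric] take_Suc_conv_app_nth)

lemma walk_drop:
  assumes "walk E A B p" "i < length p"
  shows "walk E {p ! i} B (drop i p)"
  using walk_split(2)[of E A B "take i p" "p ! i" "drop (Suc i) p"] assms
  by (simp add: id_take_nth_drop[symmetric] Cons_nth_drop_Suc)

lemma walk_weaken:
  assumes "walk E A B p" "A \<subseteq> A'" "B \<subseteq> B'"
  shows "walk E A' B' p"
  using assms by (auto simp: walk_def)

text \<open>A chord, a repeated vertex, a later visit to \<open>A\<close> or an earlier visit to
  \<open>B\<close> each allow a shortcut within \<open>U\<close>, so a shortest walk has none of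
  them.\<close>

lemma chordless_path_exists:
  assumes "walk E A B p" "set p \<subseteq> U"
  obtains q where "AB_path U E A B q" "chordless E q"
proof -
  define W where "W q \<longleftrightarrow> walk E A B q \<and> set q \<subseteq> U" for q
  have "W p" using assms by (simp add: W_def)
  then obtain q where q: "W q" and least: "\<And>r. W r \<Longrightarrow> length q \<le> length r"
    using ex_has_least_nat[of W p length] by blast
  have w: "walk E A B q" "set q \<subseteq> U" using q by (auto simp: W_def)
  have ne: "q \<noteq> []" using w(1) by (simp add: walk_def)
  have sub: "set (take i q) \<subseteq> U" "set (drop i q) \<subseteq> U" for i
    using w(2) set_take_subset[of i q] set_drop_subset[of i q] by auto
  have no_chord: "\<not> E (q ! i) (q ! j)" if ij: "Suc i < j" "j < length q" for i j
  proof
    assume "E (q ! i) (q ! j)"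
    then have "walk E A B (take (Suc i) q @ drop j q)"
      using walk_concat[OF walk_take[OF w(1), of i] walk_drop[OF w(1), of j]] ij
      by (simp add: take_Suc_conv_app_nth hd_drop_conv_nth)
    then have "W (take (Suc i) q @ drop j q)" using sub by (simp add: W_def)
    then show False using least ij by fastforce
  qed
  have dist: "q ! i \<noteq> q ! j" if ij: "i < j" "j < length q" for i j
  proof
    assume eq: "q ! i = q ! j"
    have "walk E A {q ! i} (take i q @ [q ! j])"
      using walk_take[OF w(1), of i] ij eq by (simp add: take_Suc_conv_app_nth)
    moreover have "walk E {q ! j} B (q ! j # drop (Suc j) q)"
      using walk_drop[OF w(1), of j] ij by (simp add: Cons_nth_drop_Suc)
    ultimately have "walk E A B (take i q @ q ! j # drop (Suc j) q)" by (rule walk_join)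
    then have "W (take i q @ drop j q)" using sub ij by (simp add: W_def Cons_nth_drop_Suc)
    then show False using least ij by fastforce
  qed
  have starts: "i = 0" if "i < length q" "q ! i \<in> A" for i
  proof -
    have "W (drop i q)"
      using walk_weaken[OF walk_drop[OF w(1) that(1)], of A B] that sub by (simp add: W_def)
    then show ?thesis using least that by fastforce
  qed
  have ends: "Suc i = length q" if "i < length q" "q ! i \<in> B" for i
  proof -
    have "W (take (Suc i) q)"
      using walk_weaken[OF walk_take[OF w(1) that(1)], of A B] that sub by (simp add: W_def)
    then show ?thesis using least that by fastforce
  qed
  have "set q \<inter> A = {hd q}"
  proof -
    have "hd q \<in> set q \<inter> A" using w(1) by (simp add: walk_def)
    moreover have "x = hd q" if "x \<in> set q" "x \<in> A" for x
      using that starts ne by (metis hd_conv_nth in_set_conv_nth)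
    ultimately show ?thesis by blast
  qed
  moreover have "set q \<inter> B = {last q}"
  proof -
    have "last q \<in> set q \<inter> B" using w(1) by (simp add: walk_def)
    moreover have "x = last q" if "x \<in> set q" "x \<in> B" for x
      using that ends ne by (metis last_conv_nth in_set_conv_nth diff_Suc_1)
    ultimately show ?thesis by blast
  qed
  moreover have "is_path U E q"
    using w ne dist unfolding is_path_def walk_def successively_conv_nth distinct_conv_nth
    by (metis linorder_neqE_nat)
  ultimately show ?thesis using that no_chord unfolding AB_path_def chordless_def by blast
qed

lemma AB_path_walk:
  assumes "AB_path U E A B p"
  shows "walk E A B p" "set p \<subseteq> U"
  using assms unfolding AB_path_def is_path_def walk_def successively_conv_nth by auto

text \<open>Unordered pairs are used to match the edge condition of
  \<open>induced_linkage\<close>.\<close>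

definition path_nbrs :: "'a list \<Rightarrow> 'a \<Rightarrow> 'a set" where
  "path_nbrs p x = {y. \<exists>i. Suc i < length p \<and> {p ! i, p ! Suc i} = {x, y}}"

lemma path_nbrs_nth:
  assumes "distinct p" "i < length p"
  shows "path_nbrs p (p ! i) =
    (if i = 0 then {} else {p ! (i - 1)}) \<union> (if Suc i < length p then {p ! Suc i} else {})"
proof (intro equalityI subsetI)
  fix y assume "y \<in> path_nbrs p (p ! i)"
  then obtain j where j: "Suc j < length p" "{p ! j, p ! Suc j} = {p ! i, y}"
    unfolding path_nbrs_def by blast
  then have "p ! i = p ! j \<and> y = p ! Suc j \<or> p ! i = p ! Suc j \<and> y = p ! j"
    by (auto simp: doubleton_eq_iff)
  then have "i = j \<and> y = p ! Suc j \<or> i = Suc j \<and> y = p ! j"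
    using assms j(1) by (auto simp: nth_eq_iff_index_eq)
  then show "y \<in> (if i = 0 then {} else {p ! (i - 1)}) \<union>
      (if Suc i < length p then {p ! Suc i} else {})"
    using j(1) by auto
next
  fix y assume *: "y \<in> (if i = 0 then {} else {p ! (i - 1)}) \<union>
      (if Suc i < length p then {p ! Suc i} else {})"
  show "y \<in> path_nbrs p (p ! i)"
  proof (cases "i \<noteq> 0 \<and> y = p ! (i - 1)")
    case True
    then show ?thesis using assms(2) unfolding path_nbrs_def
      by (auto intro!: exI[of _ "i - 1"])
  next
    case False
    then have "Suc i < length p" "y = p ! Suc i" using * by (auto split: if_splits)
    then show ?thesis unfolding path_nbrs_def by blast
  qed
qed

text \<open>An \<open>A\<close>-\<open>B\<close>-path meets \<open>A\<close> only at its start and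
  \<open>B\<close> only at its end, so each indicator stands for exactly the neighbour missing
  there. A one-vertex path has both indicators equal to 1.\<close>

lemma card_path_nbrs:
  assumes "AB_path U E A B p" "x \<in> set p"
  shows "card (path_nbrs p x) + of_bool (x \<in> A) + of_bool (x \<in> B) = 2"
proof -
  have p: "distinct p" "p \<noteq> []" "set p \<inter> A = {hd p}" "set p \<inter> B = {last p}"
    using assms(1) unfolding AB_path_def is_path_def by auto
  obtain i where i: "i < length p" "x = p ! i" using assms(2) by (metis in_set_conv_nth)
  have "x \<in> A \<longleftrightarrow> x = p ! 0"
    using p(2,3) assms(2) by (metis IntI Int_iff hd_conv_nth insertI1 singletonD)
  then have A: "x \<in> A \<longleftrightarrow> i = 0" using i p(1,2) by (simp add: nth_eq_iff_index_eq)
  have "x \<in> B \<longleftrightarrow> x = p ! (length p - 1)"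
    using p(2,4) assms(2) by (metis IntI Int_iff last_conv_nth insertI1 singletonD)
  then have B: "x \<in> B \<longleftrightarrow> \<not> Suc i < length p"
    using i p(1,2) by (auto simp: nth_eq_iff_index_eq)
  have "p ! (i - 1) \<noteq> p ! Suc i" if "i \<noteq> 0" "Suc i < length p"
    using that p(1) by (simp add: nth_eq_iff_index_eq)
  then have "i \<noteq> 0 \<Longrightarrow> Suc i < length p \<Longrightarrow> card {p ! Suc i, p ! (i - 1)} = 2"
    by (metis card_2_iff)
  then show ?thesis using A B path_nbrs_nth[OF p(1) i(1)] i(2) by simp
qed

lemma path_nbrs_adjacent:
  assumes "graph V E" "AB_path U E A B p"
  shows "path_nbrs p x \<subseteq> {y \<in> set p. E x y}"
proof
  fix y assume "y \<in> path_nbrs p x"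
  then obtain i where i: "Suc i < length p" "{p ! i, p ! Suc i} = {x, y}"
    unfolding path_nbrs_def by blast
  then have "E (p ! i) (p ! Suc i)" using assms(2) unfolding AB_path_def is_path_def by blast
  moreover have "p ! i \<in> set p" "p ! Suc i \<in> set p" using i(1) by auto
  ultimately show "y \<in> {y \<in> set p. E x y}"
    using i(2) assms(1) unfolding graph_def by (auto simp: doubleton_eq_iff)
qed

lemma chordless_nbrs:
  assumes "graph V E" "chordless E p" "x \<in> set p" "y \<in> set p" "E x y"
  shows "y \<in> path_nbrs p x"
proof -
  obtain i j where ij: "i < length p" "x = p ! i" "j < length p" "y = p ! j"
    using assms(3,4) by (metis in_set_conv_nth)
  have "E y x" "x \<noteq> y" using assms(1,5) unfolding graph_def by auto
  then have "\<not> Suc i < j" "\<not> Suc j < i" "i \<noteq> j"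
    using assms(2,5) ij unfolding chordless_def by auto
  then have "j = Suc i \<or> i = Suc j" by linarith
  then show ?thesis using ij unfolding path_nbrs_def by (auto simp: insert_commute)
qed

text \<open>By \<open>card_path_nbrs\<close> the path through \<open>x\<close> already uses up all
  the degree that the bound allows \<open>x\<close> in \<open>U\<close>. No edge is left for a chord
  or for a connection to another path.\<close>

lemma induced_linkage_of_disjoint_paths:
  assumes "graph V E" "U \<subseteq> V" "finite P"
    and paths: "\<And>p. p \<in> P \<Longrightarrow> AB_path U E A B p"
    and disj: "\<And>p q. p \<in> P \<Longrightarrow> q \<in> P \<Longrightarrow> p \<noteq> q \<Longrightarrow> set p \<inter> set q = {}"
    and deg: "\<And>x. x \<in> U \<Longrightarrow> card {y \<in> U. E x y} + of_bool (x \<in> A) + of_bool (x \<in> B) \<le> 2"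
  shows "\<exists>Ps. induced_linkage V E A B (card P) Ps"
proof -
  obtain Ps where Ps: "set Ps = P" "distinct Ps" using finite_distinct_list[OF assms(3)] by blast
  have len: "length Ps = card P" using Ps distinct_card by fastforce
  have "AB_path V E A B p" if "p \<in> P" for p
    using paths[OF that] assms(2) unfolding AB_path_def is_path_def by auto
  moreover have "set (Ps ! i) \<inter> set (Ps ! j) = {}" if "i < card P" "j < card P" "i \<noteq> j" for i j
    using that len Ps disj nth_mem nth_eq_iff_index_eq by metis
  moreover have "\<exists>p\<in>P. \<exists>i. Suc i < length p \<and> {p ! i, p ! Suc i} = {u, v}"
    if uv: "p \<in> P" "u \<in> set p" "q \<in> P" "v \<in> set q" "E u v" for p q u v
  proof -
    have U: "u \<in> U" "v \<in> U" "set p \<subseteq> U" using uv AB_path_walk(2)[OF paths] by blast+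
    have "path_nbrs p u \<subseteq> {y \<in> U. E u y}"
      using path_nbrs_adjacent[OF assms(1) paths[OF uv(1)], of u] U(3) by blast
    moreover have "card {y \<in> U. E u y} \<le> card (path_nbrs p u)"
      using deg[OF U(1)] card_path_nbrs[OF paths[OF uv(1)] uv(2)] by linarith
    moreover have "finite {y \<in> U. E u y}" using assms(1,2) finite_subset unfolding graph_def by fastforce
    ultimately have "path_nbrs p u = {y \<in> U. E u y}" by (metis card_seteq)
    then have "v \<in> path_nbrs p u" using U uv(5) by simp
    then show ?thesis using uv(1) unfolding path_nbrs_def by blast
  qed
  ultimately have "induced_linkage V E A B (card P) Ps"
    unfolding induced_linkage_def using Ps len by auto
  then show ?thesis by blast
qed

section \<open>Contraction of connected fibres\<close>

text \<open>The separator consists of values of \<open>f\<close>, each blocking its whole fibre. The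
  map is a parameter since it is used both for the twin classes and for their contractions.\<close>

definition fibre_separator ::
  "('a \<Rightarrow> 'a \<Rightarrow> bool) \<Rightarrow> 'a set \<Rightarrow> 'a set \<Rightarrow> 'a set \<Rightarrow> ('a \<Rightarrow> 'b) \<Rightarrow> 'b set \<Rightarrow> bool" where
  "fibre_separator E A B U f F \<longleftrightarrow>
     finite F \<and> (\<forall>p. walk E A B p \<longrightarrow> set p \<subseteq> U \<longrightarrow> f ` set p \<inter> F \<noteq> {})"

definition restr :: "('a \<Rightarrow> 'a \<Rightarrow> bool) \<Rightarrow> 'a set \<Rightarrow> 'a \<Rightarrow> 'a \<Rightarrow> bool" where
  "restr E U x y \<longleftrightarrow> E x y \<and> x \<in> U \<and> y \<in> U"

lemma restr_rtranclp_mono: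
  assumes "(restr E U)\<^sup>*\<^sup>* x y" "U \<subseteq> U'"
  shows "(restr E U')\<^sup>*\<^sup>* x y"
  using assms(1) by (rule rtranclp_mono[THEN predicate2D, rotated]) (use assms(2) in \<open>auto simp: restr_def\<close>)

lemma walk_of_rtranclp:
  assumes "(restr E U)\<^sup>*\<^sup>* x y" "x \<in> U"
  shows "\<exists>p. walk E {x} {y} p \<and> set p \<subseteq> U"
  using assms
proof (induction rule: rtranclp_induct)
  case base
  then show ?case by (intro exI[of _ "[x]"]) (simp add: walk_def)
next
  case (step y z)
  then obtain p where p: "walk E {x} {y} p" "set p \<subseteq> U" by blast
  then have "walk E {x} {z} (p @ [z])"
    using step(2) walk_concat[OF p(1), of "{z}" "{z}" "[z]"] by (simp add: walk_def restr_def)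
  then show ?case using p step by (intro exI[of _ "p @ [z]"]) (auto simp: restr_def)
qed

text \<open>Each step of \<open>q\<close> is realised by some edge; its ends are reached by moving
  inside the connected fibres.\<close>

lemma lift_quotient_walk:
  assumes fibres: "\<And>u v. u \<in> U \<Longrightarrow> v \<in> U \<Longrightarrow> f u = f v \<Longrightarrow>
      (restr E {w \<in> U. f w = f u})\<^sup>*\<^sup>* u v"
    and "successively (\<lambda>a b. \<exists>u\<in>U. \<exists>v\<in>U. E u v \<and> f u = a \<and> f v = b) q"
    and "q \<noteq> []" "u \<in> U" "v \<in> U" "f u = hd q" "f v = last q"
  shows "(restr E {w \<in> U. f w \<in> set q})\<^sup>*\<^sup>* u v"
  using assms(2-)
proof (induction q arbitrary: u rule: induct_list012)
  case (2 a)
  then show ?case using fibres[of u v] by simp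
next
  case (3 a b q)
  obtain u' v' where e: "u' \<in> U" "v' \<in> U" "E u' v'" "f u' = a" "f v' = b" using 3(3) by auto
  have "(restr E {w \<in> U. f w \<in> set (b # q)})\<^sup>*\<^sup>* v' v"
    using "3.IH"(2)[of v'] 3 e by simp
  then have "(restr E {w \<in> U. f w \<in> set (a # b # q)})\<^sup>*\<^sup>* v' v"
    by (rule restr_rtranclp_mono) auto
  moreover have "restr E {w \<in> U. f w \<in> set (a # b # q)} u' v'" using e by (simp add: restr_def)
  moreover have "(restr E {w \<in> U. f w = f u})\<^sup>*\<^sup>* u u'" using fibres[of u u'] 3 e by simp
  then have "(restr E {w \<in> U. f w \<in> set (a # b # q)})\<^sup>*\<^sup>* u u'"
    by (rule restr_rtranclp_mono) (use 3 in auto)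
  ultimately show ?case by (meson converse_rtranclp_into_rtranclp rtranclp_trans)
qed simp

text \<open>This is Menger's theorem after contracting every fibre to a point. Quotient paths lift
  into the fibres they visit, so no fibre is met by two of the resulting paths, which is stronger
  than having no common vertex.\<close>

lemma menger_fibres:
  assumes "finite U"
    and fibres: "\<And>u v. u \<in> U \<Longrightarrow> v \<in> U \<Longrightarrow> f u = f v \<Longrightarrow>
      (restr E {w \<in> U. f w = f u})\<^sup>*\<^sup>* u v"
    and sep: "\<And>F. fibre_separator E A B U f F \<Longrightarrow> m \<le> card F"
  shows "\<exists>P. card P = m \<and> (\<forall>p\<in>P. AB_path U E A B p \<and> chordless E p) \<and>
    (\<forall>p\<in>P. \<forall>q\<in>P. p \<noteq> q \<longrightarrow> f ` set p \<inter> f ` set q = {})"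
proof -
  \<comment> \<open>An edge inside a fibre becomes a loop of \<open>r\<close>, so the image of a
    walk is a walk as it stands.\<close>
  define r where "r = {(f u, f v) | u v. u \<in> U \<and> v \<in> U \<and> E u v}"
  define A' where "A' = f ` (A \<inter> U)"
  define B' where "B' = f ` (B \<inter> U)"
  have "r \<subseteq> f ` U \<times> f ` U" by (auto simp: r_def)
  then have fin: "finite r" "finite A'"
    using assms(1) finite_subset[of r "f ` U \<times> f ` U"] by (simp_all add: A'_def)
  have "m \<le> card S" if S: "separator (\<lambda>x y. (x, y) \<in> r) A' B' S" for S
  proof (rule sep)
    have "f ` set p \<inter> S \<noteq> {}" if p: "walk E A B p" "set p \<subseteq> U" for p
    proof -
      have "(f a, f b) \<in> r" if "a \<in> set p" "b \<in> set p" "E a b" for a b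
        using that p(2) unfolding r_def by blast
      then have "successively (\<lambda>a b. (f a, f b) \<in> r) p"
        using p(1) successively_mono[of E p "\<lambda>a b. (f a, f b) \<in> r"] by (simp add: walk_def)
      moreover have "p \<noteq> []" "hd p \<in> A \<inter> U" "last p \<in> B \<inter> U"
        using p unfolding walk_def by auto
      ultimately have "walk (\<lambda>x y. (x, y) \<in> r) A' B' (map f p)"
        unfolding walk_def A'_def B'_def by (simp add: successively_map hd_map last_map)
      moreover have "set q \<inter> S \<noteq> {}" if "walk (\<lambda>x y. (x, y) \<in> r) A' B' q" for q
        using S that by (simp add: separator_def)
      ultimately have "set (map f p) \<inter> S \<noteq> {}" by blast
      then show ?thesis by simp
    qed
    then show "fibre_separator E A B U f S"
      using S by (simp add: fibre_separator_def separator_def)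
  qed
  then obtain Q where Q: "card Q = m" "disjoint_paths (\<lambda>x y. (x, y) \<in> r) A' B' Q"
    using menger[OF fin, of B' m] by auto
  have "\<exists>p. AB_path {w \<in> U. f w \<in> set q} E A B p \<and> chordless E p" if "q \<in> Q" for q
  proof -
    have q: "q \<noteq> []" "hd q \<in> A'" "last q \<in> B'" "successively (\<lambda>x y. (x, y) \<in> r) q"
      using Q(2) that unfolding disjoint_paths_def walk_def by auto
    obtain u v where uv: "u \<in> A" "u \<in> U" "f u = hd q" "v \<in> B" "v \<in> U" "f v = last q"
      using q(2,3) unfolding A'_def B'_def by auto
    have r_iff: "(\<lambda>x y. (x, y) \<in> r) = (\<lambda>a b. \<exists>u\<in>U. \<exists>v\<in>U. E u v \<and> f u = a \<and> f v = b)"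
      unfolding r_def by (intro ext) blast
    have "(restr E {w \<in> U. f w \<in> set q})\<^sup>*\<^sup>* u v"
      by (rule lift_quotient_walk[OF fibres q(4)[unfolded r_iff] q(1) uv(2,5,3,6)])
    moreover have "u \<in> {w \<in> U. f w \<in> set q}" using uv q(1) by simp
    ultimately obtain p where p: "walk E {u} {v} p" "set p \<subseteq> {w \<in> U. f w \<in> set q}"
      using walk_of_rtranclp[of E "{w \<in> U. f w \<in> set q}" u v] by blast
    have "walk E A B p" by (rule walk_weaken[OF p(1)]) (use uv in auto)
    then show ?thesis by (rule chordless_path_exists[OF _ p(2)]) blast
  qed
  then have "\<forall>q\<in>Q. \<exists>p. AB_path {w \<in> U. f w \<in> set q} E A B p \<and> chordless E p" by blast
  from bchoice[OF this] obtain h where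
    h: "\<And>q. q \<in> Q \<Longrightarrow> AB_path {w \<in> U. f w \<in> set q} E A B (h q) \<and> chordless E (h q)"
    by blast
  have im: "f ` set (h q) \<subseteq> set q" "set (h q) \<subseteq> U" "h q \<noteq> []" if "q \<in> Q" for q
    using AB_path_walk[of "{w \<in> U. f w \<in> set q}" E A B "h q"] h[OF that] by (auto simp: walk_def)
  have disj: "f ` set (h q) \<inter> f ` set (h q') = {}" if "q \<in> Q" "q' \<in> Q" "q \<noteq> q'" for q q'
  proof -
    have "set q \<inter> set q' = {}" using Q(2) that unfolding disjoint_paths_def by blast
    then show ?thesis using im(1)[OF that(1)] im(1)[OF that(2)] by blast
  qed
  have "inj_on h Q"
  proof (rule inj_onI, rule ccontr)
    fix q q' assume *: "q \<in> Q" "q' \<in> Q" "h q = h q'" "q \<noteq> q'"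
    then show False using disj[OF *(1,2,4)] im(3)[OF *(1)] by simp
  qed
  show ?thesis
  proof (intro exI[of _ "h ` Q"] conjI ballI impI)
    show "card (h ` Q) = m" using Q(1) card_image[OF \<open>inj_on h Q\<close>] by simp
    show "AB_path U E A B p" "chordless E p" if p: "p \<in> h ` Q" for p
    proof -
      obtain q where "q \<in> Q" "p = h q" using p by blast
      then show "AB_path U E A B p" "chordless E p"
        using h[of q] im(2)[of q] by (simp_all add: AB_path_def is_path_def)
    qed
    show "f ` set p \<inter> f ` set p' = {}" if p: "p \<in> h ` Q" "p' \<in> h ` Q" "p \<noteq> p'" for p p'
    proof -
      obtain q q' where "q \<in> Q" "p = h q" "q' \<in> Q" "p' = h q'" using p by blast
      then show ?thesis using disj[of q q'] p(3) by blast
    qed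
  qed
qed

section \<open>Partitions into classes of twins\<close>

text \<open>A new element avoids the at most \<open>d\<close> colours of the elements in conflict
  with it, and \<open>Suc d\<close> colours leave one free.\<close>

lemma greedy_colouring:
  fixes conf :: "'b \<Rightarrow> 'b \<Rightarrow> bool"
  assumes "finite W" "\<And>x y. conf x y \<Longrightarrow> conf y x"
    and "\<And>x. x \<in> W \<Longrightarrow> card {y \<in> W. y \<noteq> x \<and> conf x y} \<le> d"
  shows "\<exists>col. (\<forall>x. col x < Suc d) \<and> (\<forall>x\<in>W. \<forall>y\<in>W. x \<noteq> y \<and> conf x y \<longrightarrow> col x \<noteq> col y)"
  using assms(1,3)
proof (induction W rule: finite_induct)
  case (insert z W)
  have "card {y \<in> W. y \<noteq> x \<and> conf x y} \<le> d" if "x \<in> W" for x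
    using card_mono[of "{y \<in> insert z W. y \<noteq> x \<and> conf x y}" "{y \<in> W. y \<noteq> x \<and> conf x y}"]
      insert.prems[of x] insert.hyps(1) that by fastforce
  then obtain col where col: "\<And>x. col x < Suc d"
    "\<And>x y. x \<in> W \<Longrightarrow> y \<in> W \<Longrightarrow> x \<noteq> y \<Longrightarrow> conf x y \<Longrightarrow> col x \<noteq> col y"
    using insert.IH by blast
  define N where "N = {y \<in> W. conf z y}"
  have "N = {y \<in> insert z W. y \<noteq> z \<and> conf z y}" using insert.hyps(2) by (auto simp: N_def)
  then have "card N \<le> d" using insert.prems[of z] by simp
  moreover have "finite N" using insert.hyps(1) by (simp add: N_def)
  ultimately have "card (col ` N) < card {..<Suc d}" "finite (col ` N)"
    using card_image_le[of N col] by auto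
  then obtain a where a: "a < Suc d" "a \<notin> col ` N"
    by (metis card_mono lessThan_iff not_less subsetI)
  define col' where "col' = col(z := a)"
  have "col' x \<noteq> col' y" if "x \<in> insert z W" "y \<in> insert z W" "x \<noteq> y" "conf x y" for x y
  proof -
    have "conf y x" using assms(2) that(4) by blast
    then show ?thesis using that col(2)[of x y] a(2) unfolding col'_def N_def by auto
  qed
  moreover have "col' x < Suc d" for x using col(1) a(1) by (simp add: col'_def)
  ultimately show ?case by blast
qed auto

definition closed_nbhd :: "('a \<Rightarrow> 'a \<Rightarrow> bool) \<Rightarrow> 'a \<Rightarrow> 'a set" where
  "closed_nbhd E v = insert v {w. E v w}"

text \<open>These are the only facts about maximal cliques that the main argument uses. The intended
  \<open>c v\<close> is the set of maximal cliques containing \<open>v\<close>, with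
  \<open>D = t * (s - 1)\<close>.\<close>

locale twin_partition =
  fixes V :: "'a set" and E :: "'a \<Rightarrow> 'a \<Rightarrow> bool" and A B :: "'a set"
    and c :: "'a \<Rightarrow> 'b" and D :: nat
  assumes graph: "graph V E"
    and twins: "u \<in> V \<Longrightarrow> v \<in> V \<Longrightarrow> c u = c v \<Longrightarrow> closed_nbhd E u = closed_nbhd E v"
    and few_classes: "v \<in> V \<Longrightarrow> card (c ` closed_nbhd E v) \<le> D + 1"
begin

abbreviation "nbhd \<equiv> closed_nbhd E"

abbreviation "separates U F \<equiv> fibre_separator E A B U c F"

definition inseparable :: "'a set \<Rightarrow> nat \<Rightarrow> bool" where
  "inseparable U m \<longleftrightarrow> (\<forall>F. separates U F \<longrightarrow> m \<le> card F)"

text \<open>The number of neighbours of \<open>x\<close> on an \<open>A\<close>-\<open>B\<close>-path through \<open>x\<close> is 2, less one for each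
  of \<open>x \<in> A\<close> and \<open>x \<in> B\<close>. Hence all neighbours of a tame vertex lie next to it on any such path,
  and unlike a condition on a particular path system, this is inherited by subsets.\<close>

definition tame :: "'a set \<Rightarrow> 'a \<Rightarrow> bool" where
  "tame U x \<longleftrightarrow> card {y \<in> U. E x y} + of_bool (x \<in> A) + of_bool (x \<in> B) \<le> 2"

lemma finite_V: "finite V" and E_sym: "E u v \<Longrightarrow> E v u" and E_V: "E u v \<Longrightarrow> u \<in> V \<and> v \<in> V"
  using graph unfolding graph_def by blast+

lemma nbhd_self: "v \<in> nbhd v" and nbhd_sym: "u \<in> nbhd v \<longleftrightarrow> v \<in> nbhd u"
  using E_sym by (auto simp: closed_nbhd_def)

lemma nbhd_subset: "v \<in> V \<Longrightarrow> nbhd v \<subseteq> V"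
  using E_V by (auto simp: closed_nbhd_def)

lemma finite_nbhd: "v \<in> V \<Longrightarrow> finite (nbhd v)"
  using nbhd_subset finite_V finite_subset by metis

lemma tame_mono:
  assumes "tame U x" "U' \<subseteq> U" "U \<subseteq> V"
  shows "tame U' x"
proof -
  have "finite {y \<in> U. E x y}" using assms(3) finite_V finite_subset by fastforce
  then have "card {y \<in> U'. E x y} \<le> card {y \<in> U. E x y}"
    using assms(2) by (intro card_mono) auto
  then show ?thesis using assms(1) unfolding tame_def by linarith
qed

section \<open>Colouring the classes\<close>

definition conflict :: "'b \<Rightarrow> 'b \<Rightarrow> bool" where
  "conflict a b \<longleftrightarrow> (\<exists>u\<in>V. \<exists>v\<in>V. c u = a \<and> c v = b \<and> nbhd u \<inter> nbhd v \<noteq> {})"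

text \<open>A conflict of the class of \<open>u\<close> with that of \<open>v\<close> has a witness
  \<open>w\<close> adjacent or equal to both, up to twins. There are at most \<open>D\<close>
  choices for the class of \<open>w\<close> other than \<open>c u\<close>, and for each at most
  \<open>D\<close> for the class of \<open>v\<close>, because \<open>c u\<close> itself is among the
  \<open>D + 1\<close> classes seen from \<open>w\<close>.\<close>

lemma card_conflicts:
  assumes u: "u \<in> V"
  shows "card {b \<in> c ` V. b \<noteq> c u \<and> conflict (c u) b} \<le> D ^ 2"
proof -
  define others where "others w = c ` nbhd w - {c u}" for w
  \<comment> \<open>A representative inside \<open>nbhd u\<close> for each class meeting it; twins
    have equal closed neighbourhoods, so the choice does not affect which classes are seen from
    it.\<close>
  define rep where "rep a = (SOME w. w \<in> nbhd u \<and> c w = a)" for a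
  have rep: "rep (c w) \<in> nbhd u" "c (rep (c w)) = c w" if "w \<in> nbhd u" for w
    using someI[of "\<lambda>w'. w' \<in> nbhd u \<and> c w' = c w" w] that unfolding rep_def by auto
  have small: "card (others w) \<le> D" "finite (others w)" if "w \<in> nbhd u" for w
  proof -
    have w: "w \<in> V" using nbhd_subset[OF u] that by blast
    have "c u \<in> c ` nbhd w" using that nbhd_sym by blast
    then show "card (others w) \<le> D"
      using few_classes[OF w] finite_nbhd[OF w] by (simp add: others_def card_Diff_singleton)
    show "finite (others w)" using finite_nbhd[OF w] by (simp add: others_def)
  qed
  have "{b \<in> c ` V. b \<noteq> c u \<and> conflict (c u) b} \<subseteq> (\<Union>a\<in>others u. others (rep a))"
  proof
    fix b assume "b \<in> {b \<in> c ` V. b \<noteq> c u \<and> conflict (c u) b}"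
    then obtain u' v w where v: "u' \<in> V" "v \<in> V" "c u' = c u" "c v = b" "b \<noteq> c u"
      "w \<in> nbhd u'" "w \<in> nbhd v"
      unfolding conflict_def by blast
    have wu: "w \<in> nbhd u" using v twins[of u' u] u by blast
    then have w: "w \<in> V" using nbhd_subset[OF u] by blast
    have vw: "v \<in> nbhd w" using v(7) nbhd_sym by blast
    \<comment> \<open>If \<open>w\<close> is a twin of \<open>u\<close>, then \<open>v\<close> is
      adjacent to \<open>u\<close>, and the class \<open>b\<close> serves as its own intermediate
      class. This keeps the bound at \<open>D * D\<close>.\<close>
    show "b \<in> (\<Union>a\<in>others u. others (rep a))"
    proof (cases "c w = c u")
      case True
      then have vu: "v \<in> nbhd u" using vw twins[OF w u] by blast
      then have "rep b \<in> nbhd u" "c (rep b) = b" using rep[of v] v(4) by auto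
      moreover from this have "c (rep b) \<in> c ` nbhd (rep b)" "c (rep b) \<in> c ` nbhd u"
        using nbhd_self by blast+
      ultimately have "b \<in> others (rep b)" "b \<in> others u" using v(5) by (simp_all add: others_def)
      then show ?thesis by blast
    next
      case False
      have r: "rep (c w) \<in> nbhd u" "c (rep (c w)) = c w" using rep[OF wu] by auto
      then have "nbhd (rep (c w)) = nbhd w" using twins[of "rep (c w)" w] nbhd_subset[OF u] w by blast
      then have "b \<in> others (rep (c w))" using vw v(4,5) by (auto simp: others_def)
      moreover have "c w \<in> others u" using wu False by (auto simp: others_def)
      ultimately show ?thesis by blast
    qed
  qed
  moreover have inner: "card (others (rep a)) \<le> D \<and> finite (others (rep a))" if "a \<in> others u" for a
    using that rep(1) small by (auto simp: others_def)
  ultimately have "card {b \<in> c ` V. b \<noteq> c u \<and> conflict (c u) b} \<le> card (\<Union>a\<in>others u. others (rep a))"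
    using small(2)[OF nbhd_self] by (intro card_mono) auto
  also have "\<dots> \<le> (\<Sum>a\<in>others u. card (others (rep a)))"
    using small(2)[OF nbhd_self] by (rule card_UN_le)
  also have "\<dots> \<le> card (others u) * D" using inner sum_bounded_above[of "others u" _ D] by simp
  also have "\<dots> \<le> D ^ 2" using small(1)[OF nbhd_self] by (simp add: power2_eq_square)
  finally show ?thesis .
qed

lemma colouring_exists:
  "\<exists>col. (\<forall>a. col a < D ^ 2 + 1) \<and>
    (\<forall>u\<in>V. \<forall>v\<in>V. c u \<noteq> c v \<and> col (c u) = col (c v) \<longrightarrow> nbhd u \<inter> nbhd v = {})"
proof -
  have "\<exists>col. (\<forall>a. col a < Suc (D ^ 2)) \<and>
      (\<forall>a\<in>c ` V. \<forall>b\<in>c ` V. a \<noteq> b \<and> conflict a b \<longrightarrow> col a \<noteq> col b)"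
  proof (rule greedy_colouring)
    show "finite (c ` V)" using finite_V by simp
    show "conflict b a" if "conflict a b" for a b using that unfolding conflict_def by blast
    show "card {b \<in> c ` V. b \<noteq> a \<and> conflict a b} \<le> D ^ 2" if "a \<in> c ` V" for a
      using that card_conflicts by blast
  qed
  then obtain col :: "'b \<Rightarrow> nat" where col: "\<And>a. col a < D ^ 2 + 1"
    "\<And>a b. a \<in> c ` V \<Longrightarrow> b \<in> c ` V \<Longrightarrow> a \<noteq> b \<Longrightarrow> conflict a b \<Longrightarrow> col a \<noteq> col b" by auto
  have "nbhd u \<inter> nbhd v = {}" if "u \<in> V" "v \<in> V" "c u \<noteq> c v" "col (c u) = col (c v)" for u v
    using col(2)[of "c u" "c v"] that unfolding conflict_def by blast
  then show ?thesis using col(1) by blast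
qed

text \<open>One colour class \<open>X\<close> is made tame by contracting the neighbourhoods of its vertices, which
  costs a factor \<open>D + 1\<close>: a path system of the contracted graph uses each neighbourhood
  on at most one path.\<close>

lemma tame_colour_class:
  assumes U: "U \<subseteq> V" and X: "X \<subseteq> V" and ins: "inseparable U ((D + 1) * m)"
    and sparse: "\<And>u v. u \<in> X \<Longrightarrow> v \<in> X \<Longrightarrow> c u \<noteq> c v \<Longrightarrow> nbhd u \<inter> nbhd v = {}"
  shows "\<exists>U'\<subseteq>U. inseparable U' m \<and> (\<forall>x\<in>U' \<inter> X. tame U' x)"
proof -
  define centre where "centre x w \<longleftrightarrow> x \<in> U \<and> x \<in> X \<and> w \<in> nbhd x" for x w
  \<comment> \<open>All of \<open>nbhd x\<close> gets the label of its centre \<open>x\<close>;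
    every other vertex keeps its class. Two centres of one vertex have overlapping neighbourhoods,
    hence equal class by \<open>sparse\<close>, so the choice is harmless.\<close>
  define f where "f w = (if \<exists>x. centre x w then c (SOME x. centre x w) else c w)" for w
  have f_centre: "f w = c x" if "centre x w" for x w
  proof -
    have "centre (SOME x. centre x w) w" using that by (rule someI)
    then have "c (SOME x. centre x w) = c x"
      using that sparse[of "SOME x. centre x w" x] unfolding centre_def by blast
    then show ?thesis using that unfolding f_def by auto
  qed
  have f_plain: "f w = c w" if "\<nexists>x. centre x w" for w using that by (simp add: f_def)
  have centre_twin: "centre x v" if "centre x u" "u \<in> U" "v \<in> U" "c u = c v" for x u v
  proof -
    have "nbhd u = nbhd v" using twins that(2,3,4) U by blast
    then show ?thesis using that(1) nbhd_sym[of u x] nbhd_sym[of v x] unfolding centre_def by simp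
  qed
  have f_class: "f u = f v" if uv: "u \<in> U" "v \<in> U" "c u = c v" for u v
  proof (cases "\<exists>x. centre x u \<or> centre x v")
    case True
    then obtain x where "centre x u" "centre x v"
      using centre_twin[of _ u v] centre_twin[of _ v u] uv by metis
    then show ?thesis using f_centre[of x u] f_centre[of x v] by simp
  qed (use f_plain uv in auto)
  \<comment> \<open>Each fibre lies in the closed neighbourhood of one of its own vertices: the
    centre \<open>x\<close>, or any vertex of an uncontracted class. This makes fibres connected and
    limits them to \<open>D + 1\<close> classes.\<close>
  have hub: "\<exists>a\<in>U. f a = f u \<and> (\<forall>v\<in>U. f v = f u \<longrightarrow> v \<in> nbhd a)" if u: "u \<in> U" for u
  proof (cases "\<exists>x. centre x u")
    case True
    then obtain x where x: "centre x u" by blast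
    have xU: "x \<in> U" "x \<in> X" using x by (auto simp: centre_def)
    then have xx: "centre x x" using nbhd_self by (simp add: centre_def)
    have fu: "f u = c x" using f_centre x by blast
    have "v \<in> nbhd x" if v: "v \<in> U" "f v = f u" for v
    proof (cases "\<exists>y. centre y v")
      case True
      then obtain y where y: "centre y v" by blast
      then have "c y = c x" using f_centre v fu by metis
      then have "nbhd y = nbhd x" using twins[of y x] y xU U unfolding centre_def by blast
      then show ?thesis using y unfolding centre_def by blast
    next
      case False
      \<comment> \<open>A vertex keeping the label \<open>c x\<close> is a twin of \<open>x\<close>,
        so it would lie in \<open>nbhd x\<close> anyway: labels of the two kinds do not mix.\<close>
      then have "c v = c x" using f_plain v fu by metis
      then show ?thesis using centre_twin[OF xx xU(1) v(1)] unfolding centre_def by simp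
    qed
    then show ?thesis using xU(1) f_centre[OF xx] fu by (intro bexI[of _ x]) auto
  next
    case False
    have "v \<in> nbhd u" if v: "v \<in> U" "f v = f u" for v
    proof -
      have "\<nexists>y. centre y v"
      proof
        assume "\<exists>y. centre y v"
        then obtain y where y: "centre y v" by blast
        then have yU: "y \<in> U" "y \<in> X" by (auto simp: centre_def)
        then have "centre y y" using nbhd_self by (simp add: centre_def)
        moreover have "c y = c u" using f_centre[OF y] f_plain[OF False] v(2) by simp
        ultimately show False using centre_twin[of y y u] yU u False by blast
      qed
      then have "c v = c u" using f_plain[of v] f_plain[OF False] v(2) by simp
      then have "nbhd v = nbhd u" using twins v(1) u U by blast
      then show ?thesis using nbhd_self[of v] by simp
    qed
    then show ?thesis using u by blast
  qed
  have finU: "finite U" using U finite_V finite_subset by blast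
  have fibres: "(restr E {w \<in> U. f w = f u})\<^sup>*\<^sup>* u v" if uv: "u \<in> U" "v \<in> U" "f u = f v" for u v
  proof -
    obtain a where a: "a \<in> U" "f a = f u" "u \<in> nbhd a" "v \<in> nbhd a" using hub[OF uv(1)] uv by metis
    have "(restr E {w \<in> U. f w = f u})\<^sup>*\<^sup>* u a"
      using a uv E_sym unfolding closed_nbhd_def by (auto simp: restr_def)
    moreover have "(restr E {w \<in> U. f w = f u})\<^sup>*\<^sup>* a v"
      using a uv unfolding closed_nbhd_def by (auto simp: restr_def)
    ultimately show ?thesis by (rule rtranclp_trans)
  qed
  have sep: "m \<le> card F" if F: "fibre_separator E A B U f F" for F
  proof -
    \<comment> \<open>Replacing every label in \<open>F\<close> by the classes in its fibre turns
      \<open>F\<close> into a class separator of size at most \<open>(D + 1) * card F\<close>, to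
      which \<open>ins\<close> applies.\<close>
    define G where "G b = c ` {w \<in> U. f w = b}" for b
    have finF: "finite F" using F by (simp add: fibre_separator_def)
    have G: "card (G b) \<le> D + 1 \<and> finite (G b)" for b
    proof (cases "G b = {}")
      case False
      then obtain u where u: "u \<in> U" "f u = b" unfolding G_def by blast
      obtain a where a: "a \<in> U" "\<And>v. v \<in> U \<Longrightarrow> f v = f u \<Longrightarrow> v \<in> nbhd a" using hub[OF u(1)] by blast
      have "{w \<in> U. f w = b} \<subseteq> nbhd a" using a(2) u(2) by auto
      then have "G b \<subseteq> c ` nbhd a" unfolding G_def by (rule image_mono)
      moreover have "a \<in> V" using a(1) U by blast
      ultimately show ?thesis
        using few_classes[of a] finite_nbhd[of a] card_mono[of "c ` nbhd a" "G b"] finite_subset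
        by fastforce
    qed simp
    have "separates U (\<Union>b\<in>F. G b)"
      unfolding fibre_separator_def
    proof (intro conjI allI impI)
      show "finite (\<Union>b\<in>F. G b)" using finF G by blast
      fix p assume p: "walk E A B p" "set p \<subseteq> U"
      then have "f ` set p \<inter> F \<noteq> {}" using F unfolding fibre_separator_def by blast
      then obtain w where "w \<in> set p" "f w \<in> F" by blast
      moreover from this have "c w \<in> G (f w)" using p(2) unfolding G_def by blast
      ultimately show "c ` set p \<inter> (\<Union>b\<in>F. G b) \<noteq> {}" by blast
    qed
    then have "(D + 1) * m \<le> card (\<Union>b\<in>F. G b)" using ins unfolding inseparable_def by blast
    also have "\<dots> \<le> (\<Sum>b\<in>F. card (G b))" using finF by (rule card_UN_le)
    also have "\<dots> \<le> card F * (D + 1)" using G sum_bounded_above[of F "\<lambda>b. card (G b)" "D + 1"] by simp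
    finally have "(D + 1) * m \<le> (D + 1) * card F" by (simp only: mult.commute)
    then show ?thesis by (subst (asm) mult_le_cancel1) simp
  qed
  have "\<exists>P. card P = m \<and> (\<forall>p\<in>P. AB_path U E A B p \<and> chordless E p) \<and>
    (\<forall>p\<in>P. \<forall>q\<in>P. p \<noteq> q \<longrightarrow> f ` set p \<inter> f ` set q = {})"
    using finU fibres sep by (rule menger_fibres)
  then obtain P where P: "card P = m"
    and paths: "\<And>p. p \<in> P \<Longrightarrow> AB_path U E A B p \<and> chordless E p"
    and disj: "\<And>p q. p \<in> P \<Longrightarrow> q \<in> P \<Longrightarrow> p \<noteq> q \<Longrightarrow> f ` set p \<inter> f ` set q = {}"
    by auto
  define U' where "U' = (\<Union>p\<in>P. set p)"
  have PU: "set p \<subseteq> U" if "p \<in> P" for p using paths[OF that] AB_path_walk(2) by blast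
  then have U'U: "U' \<subseteq> U" unfolding U'_def by blast
  show ?thesis
  proof (intro exI[of _ U'] conjI ballI)
    show "U' \<subseteq> U" by (fact U'U)
    show "inseparable U' m"
      unfolding inseparable_def
    proof (intro allI impI)
      fix F assume F: "separates U' F"
      have "\<exists>w. w \<in> set p \<and> c w \<in> F" if p: "p \<in> P" for p
      proof -
        have "walk E A B p" "set p \<subseteq> U'"
          using paths[OF p] AB_path_walk(1) p unfolding U'_def by blast+
        then show ?thesis using F unfolding fibre_separator_def by blast
      qed
      then obtain g where g: "\<And>p. p \<in> P \<Longrightarrow> g p \<in> set p \<and> c (g p) \<in> F" by metis
      \<comment> \<open>Twins share a fibre by \<open>f_class\<close>, and no fibre is met by two
        paths, so the \<open>m\<close> paths need \<open>m\<close> different classes to block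
        them.\<close>
      have "inj_on (\<lambda>p. c (g p)) P"
      proof (rule inj_onI, rule ccontr)
        fix p q assume *: "p \<in> P" "q \<in> P" "c (g p) = c (g q)" "p \<noteq> q"
        have "f (g p) = f (g q)" using f_class[of "g p" "g q"] g * PU by blast
        then show False using disj[OF *(1,2,4)] g * by blast
      qed
      moreover have "(\<lambda>p. c (g p)) ` P \<subseteq> F" using g by blast
      ultimately show "m \<le> card F"
        using P F card_inj_on_le[of "\<lambda>p. c (g p)" P F] unfolding fibre_separator_def by blast
    qed
    fix x assume "x \<in> U' \<inter> X"
    then have x: "x \<in> U'" "x \<in> X" by auto
    then obtain p where p: "p \<in> P" "x \<in> set p" unfolding U'_def by blast
    have AB: "AB_path U E A B p" "chordless E p" using paths[OF p(1)] by auto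
    have same: "f y = c x" if "y \<in> nbhd x" for y
      using f_centre[of x y] that x U'U unfolding centre_def by blast
    \<comment> \<open>All neighbours of \<open>x\<close> carry the label of \<open>x\<close>, so
      those kept lie on the path through \<open>x\<close>, where chordlessness puts them next to
      \<open>x\<close>.\<close>
    have "{y \<in> U'. E x y} \<subseteq> path_nbrs p x"
    proof
      fix y assume "y \<in> {y \<in> U'. E x y}"
      then obtain q where q: "q \<in> P" "y \<in> set q" "E x y" unfolding U'_def by blast
      have "f y = f x" using same[of y] same[OF nbhd_self] q(3) by (simp add: closed_nbhd_def)
      then have "p = q" using disj[OF p(1) q(1)] p(2) q(2) by force
      then show "y \<in> path_nbrs p x" using chordless_nbrs[OF graph AB(2) p(2)] q by blast
    qed
    moreover have "finite (path_nbrs p x)"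
      using path_nbrs_adjacent[OF graph AB(1)] finite_subset[of _ "set p"] by blast
    ultimately have "card {y \<in> U'. E x y} \<le> card (path_nbrs p x)" by (intro card_mono)
    then show "tame U' x" using card_path_nbrs[OF AB(1) p(2)] unfolding tame_def by linarith
  qed
qed

text \<open>\<open>m\<close> is generalised because the induction hypothesis is called with
  \<open>(D + 1) * m\<close>, the spare factor paying for colour \<open>j\<close>. Smaller colours
  stay tame by \<open>tame_mono\<close>.\<close>

lemma tame_colours:
  fixes col :: "'b \<Rightarrow> nat"
  assumes col: "\<And>u v. u \<in> V \<Longrightarrow> v \<in> V \<Longrightarrow> c u \<noteq> c v \<Longrightarrow> col (c u) = col (c v) \<Longrightarrow> nbhd u \<inter> nbhd v = {}"
    and "inseparable V ((D + 1) ^ j * m)"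
  shows "\<exists>U\<subseteq>V. inseparable U m \<and> (\<forall>x\<in>U. col (c x) < j \<longrightarrow> tame U x)"
  using assms(2)
proof (induction j arbitrary: m)
  case (Suc j)
  have "inseparable V ((D + 1) ^ j * ((D + 1) * m))" using Suc.prems by (simp only: power_Suc2 mult.assoc)
  from Suc.IH[OF this] obtain U where U: "U \<subseteq> V" "inseparable U ((D + 1) * m)"
    "\<And>x. x \<in> U \<Longrightarrow> col (c x) < j \<Longrightarrow> tame U x"
    by auto
  define X where "X = {x \<in> V. col (c x) = j}"
  have sparse: "nbhd u \<inter> nbhd v = {}" if "u \<in> X" "v \<in> X" "c u \<noteq> c v" for u v
    using that col[of u v] unfolding X_def by simp
  have "X \<subseteq> V" by (auto simp: X_def)
  obtain U' where U': "U' \<subseteq> U" "inseparable U' m"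
    "\<And>x. x \<in> U' \<Longrightarrow> x \<in> X \<Longrightarrow> tame U' x"
    using tame_colour_class[OF U(1) \<open>X \<subseteq> V\<close> U(2) sparse] by auto
  have "tame U' x" if x: "x \<in> U'" "col (c x) < Suc j" for x
  proof (cases "col (c x) = j")
    case True
    then have "x \<in> X" using x(1) U'(1) U(1) by (auto simp: X_def)
    then show ?thesis by (rule U'(3)[OF x(1)])
  next
    case False
    then have "tame U x" using U(3)[of x] x U'(1) by auto
    then show ?thesis by (rule tame_mono[OF _ U'(1) U(1)])
  qed
  then show ?case using U' U(1) by blast
qed auto

text \<open>Every colour is below \<open>D ^ 2 + 1\<close>, so after all rounds each vertex of
  \<open>U\<close> is tame while \<open>k\<close> classes are still needed to separate. A last use
  of Menger's theorem, with the classes as fibres, provides the paths.\<close>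

theorem induced_menger:
  assumes "k > 0"
  shows "(\<exists>Ps. induced_linkage V E A B k Ps) \<or>
    (\<exists>F. separates V F \<and> card F < k * (D + 1) ^ (D ^ 2 + 1))"
proof (cases "inseparable V ((D + 1) ^ (D ^ 2 + 1) * k)")
  case True
  obtain col where col: "\<forall>a. col a < D ^ 2 + 1"
    "\<forall>u\<in>V. \<forall>v\<in>V. c u \<noteq> c v \<and> col (c u) = col (c v) \<longrightarrow> nbhd u \<inter> nbhd v = {}"
    using colouring_exists by auto
  have "\<exists>U\<subseteq>V. inseparable U k \<and> (\<forall>x\<in>U. col (c x) < D ^ 2 + 1 \<longrightarrow> tame U x)"
    by (rule tame_colours[OF _ True]) (use col(2) in simp)
  then obtain U where U: "U \<subseteq> V" "inseparable U k" "\<And>x. x \<in> U \<Longrightarrow> tame U x"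
    using col(1) by auto
  have finU: "finite U" using U(1) finite_V finite_subset by blast
  have fibres: "(restr E {w \<in> U. c w = c u})\<^sup>*\<^sup>* u v" if uv: "u \<in> U" "v \<in> U" "c u = c v" for u v
  proof -
    have "v \<in> nbhd u" using twins[of u v] uv U(1) nbhd_self by blast
    then show ?thesis using uv unfolding closed_nbhd_def by (auto simp: restr_def)
  qed
  have sep: "k \<le> card F" if "separates U F" for F using U(2) that unfolding inseparable_def by blast
  have "\<exists>P. card P = k \<and> (\<forall>p\<in>P. AB_path U E A B p \<and> chordless E p) \<and>
    (\<forall>p\<in>P. \<forall>q\<in>P. p \<noteq> q \<longrightarrow> c ` set p \<inter> c ` set q = {})"
    using finU fibres sep by (rule menger_fibres)
  then obtain P where P: "card P = k"
    and paths: "\<And>p. p \<in> P \<Longrightarrow> AB_path U E A B p \<and> chordless E p"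
    and disj: "\<And>p q. p \<in> P \<Longrightarrow> q \<in> P \<Longrightarrow> p \<noteq> q \<Longrightarrow> c ` set p \<inter> c ` set q = {}"
    by auto
  \<comment> \<open>An infinite \<open>P\<close> would have \<open>card P = 0\<close>, which
    \<open>k > 0\<close> excludes.\<close>
  have "finite P" using P assms card_ge_0_finite by metis
  then have "\<exists>Ps. induced_linkage V E A B (card P) Ps"
  proof (rule induced_linkage_of_disjoint_paths[OF graph U(1)])
    show "AB_path U E A B p" if "p \<in> P" for p using paths[OF that] by blast
    show "set p \<inter> set q = {}" if "p \<in> P" "q \<in> P" "p \<noteq> q" for p q using disj[OF that] by blast
    show "card {y \<in> U. E x y} + of_bool (x \<in> A) + of_bool (x \<in> B) \<le> 2" if "x \<in> U" for x
      using U(3)[OF that] by (simp add: tame_def)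
  qed
  then show ?thesis using P by simp
next
  case False
  then obtain F where "separates V F" "card F < (D + 1) ^ (D ^ 2 + 1) * k"
    unfolding inseparable_def by (meson not_less)
  then show ?thesis by (metis mult.commute)
qed

end

section \<open>Equivalence classes and maximal cliques\<close>

text \<open>A complete invariant of \<open>clique_equiv\<close> on \<open>V\<close>: it labels the
  equivalence classes and replaces the quotient throughout.\<close>

definition cliques_at :: "'a set \<Rightarrow> ('a \<Rightarrow> 'a \<Rightarrow> bool) \<Rightarrow> 'a \<Rightarrow> 'a set set" where
  "cliques_at V E v = {K. max_clique V E K \<and> v \<in> K}"

lemma max_clique_extends:
  assumes "finite V" "clique V E K"
  shows "\<exists>K'. max_clique V E K' \<and> K \<subseteq> K'"
proof -
  have "finite {K'. clique V E K'}"
    by (rule finite_subset[of _ "Pow V"]) (use assms in \<open>auto simp: clique_def\<close>)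
  then have "\<exists>K'\<in>{K'. clique V E K'}. K \<subseteq> K' \<and> (\<forall>L\<in>{K'. clique V E K'}. K' \<subseteq> L \<longrightarrow> K' = L)"
    by (rule finite_has_maximal2) (simp add: assms(2))
  then obtain K' where "clique V E K'" "K \<subseteq> K'" "\<forall>L. clique V E L \<and> K' \<subseteq> L \<longrightarrow> L = K'"
    by auto
  then have "max_clique V E K'" by (simp add: max_clique_def)
  then show ?thesis using \<open>K \<subseteq> K'\<close> by blast
qed

lemma finite_max_cliques:
  assumes "finite V"
  shows "finite {K. max_clique V E K}"
  by (rule finite_subset[of _ "Pow V"]) (use assms in \<open>auto simp: max_clique_def clique_def\<close>)

text \<open>Every edge extends to a maximal clique. Consequently vertices in the same maximal
  cliques are twins.\<close>

lemma closed_nbhd_eq_Union_cliques: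
  assumes "graph V E" "v \<in> V"
  shows "closed_nbhd E v = \<Union> (cliques_at V E v)"
proof (intro equalityI subsetI)
  fix w assume w: "w \<in> closed_nbhd E v"
  then have "clique V E {v, w}"
    using assms unfolding clique_def closed_nbhd_def graph_def by auto
  then obtain K where "max_clique V E K" "{v, w} \<subseteq> K"
    using max_clique_extends[of V E "{v, w}"] assms(1) by (auto simp: graph_def)
  then show "w \<in> \<Union> (cliques_at V E v)" unfolding cliques_at_def by auto
next
  fix w assume "w \<in> \<Union> (cliques_at V E v)"
  then obtain K where "clique V E K" "v \<in> K" "w \<in> K"
    unfolding cliques_at_def max_clique_def by auto
  then show "w \<in> closed_nbhd E v" unfolding clique_def closed_nbhd_def by auto
qed

lemma card_cliques_at_le_cideg:
  assumes "finite V" "v \<in> V"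
  shows "card (cliques_at V E v) \<le> cideg V E"
proof -
  have "{card {K. max_clique V E K \<and> v \<in> K} | v. v \<in> V} = (\<lambda>v. card (cliques_at V E v)) ` V"
    by (auto simp: cliques_at_def)
  then show ?thesis
    using assms cSup_upper[of "card (cliques_at V E v)" "(\<lambda>v. card (cliques_at V E v)) ` V"]
    by (simp add: cideg_def)
qed

lemma card_clique_classes_le_cid:
  assumes "finite V" "max_clique V E K"
  shows "card (cliques_at V E ` K) \<le> cid V E"
proof -
  let ?T = "\<lambda>K. {C \<in> V // clique_equiv V E. C \<inter> K \<noteq> {}}"
  \<comment> \<open>Translates a label into the class it labels, so that labels occurring on
    \<open>K\<close> inject into the classes counted by \<open>cid\<close>.\<close>
  define g where "g a = {w \<in> V. cliques_at V E w = a}" for a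
  have KV: "K \<subseteq> V" using assms(2) by (simp add: max_clique_def clique_def)
  have g: "g (cliques_at V E v) = clique_equiv V E `` {v}" "v \<in> g (cliques_at V E v)" if "v \<in> V" for v
    using that by (auto simp: g_def cliques_at_def clique_equiv_def)
  have "inj_on g (cliques_at V E ` K)"
  proof (rule inj_onI)
    fix a b assume ab: "a \<in> cliques_at V E ` K" "b \<in> cliques_at V E ` K" "g a = g b"
    then obtain v where "v \<in> V" "a = cliques_at V E v" using KV by blast
    then have "v \<in> g b" using g(2)[of v] ab(3) by simp
    then show "a = b" using \<open>a = cliques_at V E v\<close> by (simp add: g_def)
  qed
  moreover have "g ` (cliques_at V E ` K) \<subseteq> ?T K"
  proof
    fix C assume "C \<in> g ` (cliques_at V E ` K)"
    then obtain v where v: "v \<in> K" "C = g (cliques_at V E v)" by blast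
    then have "v \<in> V" using KV by blast
    then have "C \<in> V // clique_equiv V E" "v \<in> C"
      using g[of v] v(2) quotientI[of v V "clique_equiv V E"] by simp_all
    then show "C \<in> ?T K" using v(1) by blast
  qed
  moreover have "finite (V // clique_equiv V E)"
    by (rule finite_subset[of _ "Pow V"]) (use assms in \<open>auto simp: quotient_def clique_equiv_def\<close>)
  then have "finite (?T K)" by simp
  ultimately have "card (cliques_at V E ` K) \<le> card (?T K)" by (rule card_inj_on_le)
  also have "\<dots> \<le> cid V E"
    unfolding cid_def
  proof (rule cSup_upper)
    have "{card (?T K) | K. max_clique V E K} = (\<lambda>K. card (?T K)) ` {K. max_clique V E K}" by auto
    then show "bdd_above {card (?T K) | K. max_clique V E K}"
      using finite_max_cliques[OF assms(1)] by (intro bdd_above_finite) simp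
  qed (use assms(2) in auto)
  finally show ?thesis .
qed

text \<open>The class of \<open>v\<close> meets every maximal clique through \<open>v\<close> and is
  counted only once. Each of the at most \<open>t\<close> cliques adds at most \<open>s - 1\<close>
  further classes.\<close>

lemma twin_partition_cliques_at:
  assumes graph: "graph V E" and "cid V E \<le> s" "cideg V E \<le> t"
  shows "twin_partition V E (cliques_at V E) (t * (s - 1))"
proof
  let ?M = "cliques_at V E"
  have fin: "finite V" using graph by (simp add: graph_def)
  show "graph V E" by (fact graph)
  show "closed_nbhd E u = closed_nbhd E v" if "u \<in> V" "v \<in> V" "?M u = ?M v" for u v
    using that closed_nbhd_eq_Union_cliques[OF graph] by simp
  show "card (?M ` closed_nbhd E v) \<le> t * (s - 1) + 1" if v: "v \<in> V" for v
  proof -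
    have "finite (?M v)" using finite_max_cliques[OF fin] by (simp add: cliques_at_def)
    have K: "card (?M ` K - {?M v}) \<le> s - 1" "finite (?M ` K)" if "K \<in> ?M v" for K
    proof -
      have m: "max_clique V E K" "v \<in> K" using that by (auto simp: cliques_at_def)
      then show "finite (?M ` K)"
        using fin finite_subset unfolding max_clique_def clique_def by blast
      then show "card (?M ` K - {?M v}) \<le> s - 1"
        using m card_clique_classes_le_cid[OF fin m(1)] assms(2) by (simp add: card_Diff_singleton)
    qed
    have fin_UN: "finite (\<Union>K\<in>?M v. ?M ` K - {?M v})" using \<open>finite (?M v)\<close> K(2) by simp
    have "?M ` closed_nbhd E v \<subseteq> insert (?M v) (\<Union>K\<in>?M v. ?M ` K - {?M v})"
      using closed_nbhd_eq_Union_cliques[OF graph v] by auto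
    then have "card (?M ` closed_nbhd E v) \<le> card (insert (?M v) (\<Union>K\<in>?M v. ?M ` K - {?M v}))"
      using fin_UN by (intro card_mono) simp_all
    also have "\<dots> \<le> card (\<Union>K\<in>?M v. ?M ` K - {?M v}) + 1"
      using fin_UN by (simp only: card_insert_if) simp
    also have "card (\<Union>K\<in>?M v. ?M ` K - {?M v}) \<le> (\<Sum>K\<in>?M v. card (?M ` K - {?M v}))"
      using \<open>finite (?M v)\<close> by (rule card_UN_le)
    also have "\<dots> \<le> card (?M v) * (s - 1)"
      using K(1) sum_bounded_above[of "?M v" "\<lambda>K. card (?M ` K - {?M v})" "s - 1"] by simp
    also have "\<dots> \<le> t * (s - 1)"
      using card_cliques_at_le_cideg[OF fin v, of E] assms(3) by (intro mult_le_mono1) simp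
    finally show ?thesis by simp
  qed
qed

text \<open>Distinct twins are adjacent, so each class is a clique and one clique per element of
  \<open>F\<close> suffices.\<close>

lemma (in twin_partition) clique_cover_number_classes:
  assumes "finite F"
  shows "clique_cover_number V E {v \<in> V. c v \<in> F} \<le> card F"
proof -
  let ?S = "{v \<in> V. c v \<in> F}"
  \<comment> \<open>An element of \<open>F\<close> that labels no vertex contributes the empty
    clique.\<close>
  define \<C> where "\<C> = (\<lambda>a. {v \<in> V. c v = a}) ` F"
  have "clique ?S E C" if "C \<in> \<C>" for C
    unfolding clique_def
  proof (intro conjI ballI impI)
    show "C \<subseteq> ?S" using that by (auto simp: \<C>_def)
    fix u v assume "u \<in> C" "v \<in> C" "u \<noteq> v"
    then have "u \<in> V" "v \<in> V" "c u = c v" using that by (auto simp: \<C>_def)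
    then have "v \<in> nbhd u" using twins[of u v] nbhd_self[of v] by simp
    then show "E u v" using \<open>u \<noteq> v\<close> by (simp add: closed_nbhd_def)
  qed
  moreover have "finite \<C>" "\<Union>\<C> = ?S" using assms by (auto simp: \<C>_def)
  ultimately have "clique_cover_number V E ?S \<le> card \<C>"
    unfolding clique_cover_number_def by (intro cInf_lower) auto
  also have "\<dots> \<le> card F" unfolding \<C>_def using assms by (rule card_image_le)
  finally show ?thesis .
qed

theorem theorem1p2:
  fixes V :: "'a set" and E :: "'a \<Rightarrow> 'a \<Rightarrow> bool"
    and A B :: "'a set" and s t k :: nat
  assumes "graph V E"
    and "s > 0" and "t > 0"
    and "cid V E \<le> s" and "cideg V E \<le> t"
    and "A \<subseteq> V" and "B \<subseteq> V"
    and "k > 0"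
  shows "(\<exists>Ps. induced_linkage V E A B k Ps) \<or>
         (\<exists>S \<subseteq> V. clique_cover_number V E S
                      \<le> k * (t * (s - 1) + 1) ^ (t ^ 2 * (s - 1) ^ 2 + 1)
                  \<and> \<not> (\<exists>p. AB_path (V - S) E A B p))"
proof -
  interpret twin_partition V E A B "cliques_at V E" "t * (s - 1)"
    using twin_partition_cliques_at assms by blast
  from induced_menger[OF \<open>k > 0\<close>] show ?thesis
  proof
    assume "\<exists>F. separates V F \<and> card F < k * (t * (s - 1) + 1) ^ ((t * (s - 1))\<^sup>2 + 1)"
    then obtain F where F: "separates V F"
      "card F < k * (t * (s - 1) + 1) ^ (t ^ 2 * (s - 1) ^ 2 + 1)"
      by (auto simp: power_mult_distrib)
    \<comment> \<open>The union of the classes labelled by \<open>F\<close>: a path avoiding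
      \<open>S\<close> has no label in \<open>F\<close>, against the separation property.\<close>
    define S where "S = {v \<in> V. cliques_at V E v \<in> F}"
    have "clique_cover_number V E S \<le> card F"
      unfolding S_def using F(1) by (intro clique_cover_number_classes) (simp add: fibre_separator_def)
    moreover have "\<not> AB_path (V - S) E A B p" for p
    proof
      assume "AB_path (V - S) E A B p"
      then have p: "walk E A B p" "set p \<subseteq> V - S" by (rule AB_path_walk)+
      then have "cliques_at V E ` set p \<inter> F \<noteq> {}" using F(1) unfolding fibre_separator_def by blast
      then show False using p(2) by (auto simp: S_def)
    qed
    ultimately show ?thesis using F(2) by (intro disjI2 exI[of _ S]) (auto simp: S_def)
  qed blast
qed

end
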